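(* Let $\eta\in[\eta^\ast,1)$. Then the function $\varphi_\eta$ is an analytic function of $c$ for $c\in(0,\infty)$, and moreover the $\liminf$ in the definition of $\varphi_\eta(c)$ can be replaced by a limit for every $c\in(0,\infty)$.
   Context: $\mathbb P_p$ and $\mathbb E_p$ are probability and expectation for the Erdős–Rényi random graph $G(n,p)$ on $n$ labeled vertices, and $X$ is its number of triangles. For $\eta\in[0,1)$ and $c>0$ define $$\varphi_\eta(c)=\liminf_{n\to\infty}\frac1{n^{3/2}}\log\mathbb P_{c/\sqrt n}\big(X\le\eta\,\mathbb E_{c/\sqrt n}X\big).$$ Here $\eta^\ast=\left(\frac{W(2/e)}{2/e}\right)^{3/2}\approx0.49928$, where $W$ is the Lambert-W function, the inverse of $x\mapsto xe^x$ on the nonnegative reals. Analytic means real-analytic. *)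

theory Defs
  imports "HOL-Probability.Probability" "HOL-Library.Ramsey"
begin

text \<open>
  A graph on the vertex set \<open>{..<n}\<close> is represented by its edge set, a set of two-element
  subsets of \<open>{..<n}\<close>. The library's \<open>nsets V k\<close> is the set of all \<open>k\<close>-element subsets of \<open>V\<close>.
  For \<open>p\<close> outside \<open>[0,1]\<close>, \<open>bernoulli_pmf p\<close> clamps \<open>p\<close> to that interval.
\<close>

definition erdos_renyi :: "nat \<Rightarrow> real \<Rightarrow> nat set set pmf" where
  "erdos_renyi n p =
     map_pmf (\<lambda>present. {e \<in> nsets {..<n} 2. present e})
       (Pi_pmf (nsets {..<n} 2) False (\<lambda>_. bernoulli_pmf p))"

definition triangle_count :: "nat \<Rightarrow> nat set set \<Rightarrow> nat" where
  "triangle_count n E = card {T \<in> nsets {..<n} 3. nsets T 2 \<subseteq> E}"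

definition expected_triangles :: "nat \<Rightarrow> real \<Rightarrow> real" where
  "expected_triangles n p =
     measure_pmf.expectation (erdos_renyi n p) (\<lambda>E. real (triangle_count n E))"

definition lower_tail_prob :: "real \<Rightarrow> nat \<Rightarrow> real \<Rightarrow> real" where
  "lower_tail_prob \<eta> n p =
     measure_pmf.prob (erdos_renyi n p)
       {E. real (triangle_count n E) \<le> \<eta> * expected_triangles n p}"

text \<open>
  Here \<open>c / sqrt n\<close> is a probability only for \<open>n \<ge> c\<^sup>2\<close>. For \<open>n > c\<^sup>2\<close> and \<open>\<eta> \<ge> 0\<close> the lower
  tail has positive probability (it contains the empty graph), so the convention \<open>ln 0 = 0\<close>
  and the clamping of \<open>p\<close> affect only finitely many terms of the sequence.
\<close>

definition lower_tail_rate :: "real \<Rightarrow> real \<Rightarrow> nat \<Rightarrow> real" where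
  "lower_tail_rate \<eta> c n =
     1 / real n powr (3/2) * ln (lower_tail_prob \<eta> n (c / sqrt (real n)))"

definition phi :: "real \<Rightarrow> real \<Rightarrow> ereal" where
  "phi \<eta> c = liminf (\<lambda>n. ereal (lower_tail_rate \<eta> c n))"

definition lambert_W :: "real \<Rightarrow> real" where
  "lambert_W = the_inv_into {0..} (\<lambda>x. x * exp x)"

definition eta_star :: real where
  "eta_star = (lambert_W (2 / exp 1) / (2 / exp 1)) powr (3/2)"

definition real_analytic_on :: "(real \<Rightarrow> real) \<Rightarrow> real set \<Rightarrow> bool" where
  "real_analytic_on f S \<longleftrightarrow> (\<forall>x\<in>S. \<exists>F. (\<lambda>h. f (x + h)) has_fps_expansion F)"

end

theory Submission
  imports Defs "HOL-Complex_Analysis.Complex_Analysis"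
begin

text \<open>
  Weight a graph by \<open>l\<close> per edge and \<open>q = 1 - z\<close> per triangle, with \<open>l \<approx> c / sqrt n\<close>. The odds that
  the edge \<open>uv\<close> is present are \<open>l\<close> times a telescoping product over the vertices \<open>w\<close>, whose factors
  are \<open>1 - z P(uw, vw present)\<close> for measures in which boundedly many edges have been conditioned and
  some triangles switched off. Hence every bound \<open>l \<alpha> \<le> P(e present) \<le> l \<beta>\<close> that is uniform over such
  conditionings improves to one with \<open>exp (- a \<beta>\<^sup>2)\<close> and \<open>exp (- a \<alpha>\<^sup>2)\<close> in the limit, where \<open>a = z c\<^sup>2\<close>.
  For \<open>2 a < 1\<close> this recursion contracts to the fixed point \<open>y = exp (- a y\<^sup>2)\<close>, and finitely many
  steps determine the edge density. Integrating it in \<open>l\<close> gives the logarithm of the partition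
  function, that is, the exponential moments of the triangle count.

  A one-sided Gaertner-Ellis argument turns these into the lower tail: the optimal tilt satisfies
  \<open>q y\<^sup>3 = \<eta>\<close>, and \<open>\<eta> \<ge> eta_star\<close> forces \<open>a < 1/e\<close> there, inside the contraction regime for every \<open>c\<close>.
  Eliminating \<open>q\<close>, the saddle point solves \<open>c\<^sup>2 = - y ln y / (y\<^sup>3 - \<eta>)\<close>, whose right-hand side is strictly
  decreasing with non-vanishing derivative, so \<open>y\<close> and with it the rate are analytic in \<open>c\<close>.
\<close>

section \<open>The partition function of a hypergraph gas\<close>

locale hypergraph_gas =
  fixes P :: "'a set" and q :: real
  assumes finite_sites: "finite P" and q_pos: "0 < q" and q_le_1: "q \<le> 1"
begin

text \<open>
  Sites in \<open>M\<close> are conditioned to be present, and only the hyperedges in \<open>H\<close> are penalised.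
  Conditioning a site to be absent is expressed by dropping all hyperedges that contain it
  and adding it to \<open>M\<close>.
\<close>

definition Z :: "real \<Rightarrow> 'a set \<Rightarrow> 'a set set \<Rightarrow> real" where
  "Z l M H = (\<Sum>G\<in>Pow (P - M). l ^ card G * q ^ card {T \<in> H. T \<subseteq> G \<union> M})"

lemma Z_pos:
  assumes "0 \<le> l"
  shows "0 < Z l M H"
proof -
  have "0 < (\<lambda>G. l ^ card G * q ^ card {T \<in> H. T \<subseteq> G \<union> M}) {}"
    using q_pos by simp
  also have "\<dots> \<le> Z l M H"
    unfolding Z_def using finite_sites q_pos assms
    by (intro member_le_sum) auto
  finally show ?thesis .
qed

lemma Z_mono:
  assumes "0 \<le> l" "finite H" "H' \<subseteq> H"
  shows "Z l M H \<le> Z l M H'"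
  unfolding Z_def using assms q_pos q_le_1
  by (intro sum_mono mult_left_mono power_decreasing card_mono) auto

text \<open>Split the configurations by whether \<open>e\<close> is present; the absent part uses
  the encoding described at \<open>Z\<close>. Dividing by the left-hand side turns ratios of
  partition functions into conditional probabilities.\<close>

lemma Z_site:
  assumes "e \<in> P - M"
  shows "Z l M H = Z l (insert e M) {T \<in> H. e \<notin> T} + l * Z l (insert e M) H"
proof -
  let ?w = "\<lambda>G. l ^ card G * q ^ card {T \<in> H. T \<subseteq> G \<union> M}"
  let ?Q = "P - insert e M"
  have Q: "P - M = insert e ?Q" "e \<notin> ?Q" "finite ?Q" using assms finite_sites by auto
  have "Z l M H = (\<Sum>G\<in>Pow ?Q. ?w G) + (\<Sum>G\<in>insert e ` Pow ?Q. ?w G)"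
    unfolding Z_def Q(1) Pow_insert
  proof (rule sum.union_disjoint)
    show "finite (Pow ?Q)" "finite (insert e ` Pow ?Q)" using Q(3) by blast+
    show "Pow ?Q \<inter> insert e ` Pow ?Q = {}" by blast
  qed
  also have "(\<Sum>G\<in>Pow ?Q. ?w G) = Z l (insert e M) {T \<in> H. e \<notin> T}"
    unfolding Z_def
  proof (intro sum.cong refl)
    fix G assume G: "G \<in> Pow ?Q"
    have "{T \<in> H. T \<subseteq> G \<union> M} = {T \<in> {T \<in> H. e \<notin> T}. T \<subseteq> G \<union> insert e M}"
      using G assms by auto
    then show "?w G = l ^ card G * q ^ card {T \<in> {T \<in> H. e \<notin> T}. T \<subseteq> G \<union> insert e M}"
      by simp
  qed
  also have "(\<Sum>G\<in>insert e ` Pow ?Q. ?w G) = (\<Sum>G\<in>Pow ?Q. ?w (insert e G))"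
  proof (rule sum.reindex_cong[of "insert e"])
    show "inj_on (insert e) (Pow ?Q)" by (intro inj_onI) blast
  qed auto
  also have "\<dots> = l * Z l (insert e M) H"
    unfolding Z_def sum_distrib_left
  proof (intro sum.cong refl)
    fix G assume G: "G \<in> Pow ?Q"
    then have "finite G" "e \<notin> G" using Q(3) finite_subset[of G ?Q] by blast+
    then show "?w (insert e G) = l * (l ^ card G * q ^ card {T \<in> H. T \<subseteq> G \<union> insert e M})"
      by simp
  qed
  finally show ?thesis .
qed

text \<open>The configurations without \<open>e\<close> suffice: they range over the same remaining
  sites, but fewer hyperedges are penalised. This is the a priori bound that the probability of
  \<open>e\<close> is at most \<open>l\<close>.\<close>

lemma Z_insert_le:
  assumes "0 \<le> l" "finite H" "e \<in> P - M"
  shows "Z l (insert e M) H \<le> Z l M H"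
proof -
  have "Z l (insert e M) H \<le> Z l (insert e M) {T \<in> H. e \<notin> T}"
    using assms by (intro Z_mono) auto
  also have "\<dots> \<le> Z l M H"
    using Z_site[OF assms(3), of l H] Z_pos[OF assms(1), of "insert e M" H] assms(1)
    by simp
  finally show ?thesis .
qed

lemma Z_union_le:
  assumes "0 \<le> l" "finite H" "A \<subseteq> P"
  shows "Z l (M \<union> A) H \<le> Z l M H"
proof -
  have "finite A" using assms finite_sites finite_subset by blast
  then show ?thesis using assms(3)
  proof (induction A rule: finite_induct)
    case (insert e A)
    show ?case
    proof (cases "e \<in> M \<union> A")
      case True
      then have "M \<union> insert e A = M \<union> A" by auto
      with insert show ?thesis by simp
    next
      case False
      then have "Z l (insert e (M \<union> A)) H \<le> Z l (M \<union> A) H"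
        using insert assms by (intro Z_insert_le) auto
      with insert show ?thesis by simp
    qed
  qed auto
qed

text \<open>A penalised hyperedge contributes q to the power of the indicator of its presence, which
  is 1 - (1 - q) times that indicator. Only the sites of \<open>T\<close> outside \<open>M\<close>
  still have to be paid for with \<open>l\<close>. Each factor of the telescoping product comes from
  here.\<close>

lemma Z_hyperedge:
  assumes "T \<in> H" "finite H" "T - M \<subseteq> P"
  shows "Z l M H = Z l M (H - {T}) - (1 - q) * l ^ card (T - M) * Z l (M \<union> T) (H - {T})"
proof -
  let ?w = "\<lambda>G. l ^ card G * q ^ card {U \<in> H - {T}. U \<subseteq> G \<union> M}"
  have fin: "finite (Pow (P - M))" using finite_sites by auto
  have pt: "l ^ card G * q ^ card {U \<in> H. U \<subseteq> G \<union> M} = ?w G - (if T \<subseteq> G \<union> M then (1 - q) * ?w G else 0)"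
    for G
  proof (cases "T \<subseteq> G \<union> M")
    case True
    then have "{U \<in> H. U \<subseteq> G \<union> M} = insert T {U \<in> H - {T}. U \<subseteq> G \<union> M}"
      using assms by auto
    then have "card {U \<in> H. U \<subseteq> G \<union> M} = Suc (card {U \<in> H - {T}. U \<subseteq> G \<union> M})"
      using assms(2) by simp
    then show ?thesis using True by (simp add: algebra_simps)
  next
    case False
    then have "{U \<in> H. U \<subseteq> G \<union> M} = {U \<in> H - {T}. U \<subseteq> G \<union> M}" by auto
    then show ?thesis using False by simp
  qed
  have "Z l M H = Z l M (H - {T}) - (\<Sum>G\<in>Pow (P - M). if T \<subseteq> G \<union> M then (1 - q) * ?w G else 0)"
    unfolding Z_def pt by (simp add: sum_subtractf)
  also have "(\<Sum>G\<in>Pow (P - M). if T \<subseteq> G \<union> M then (1 - q) * ?w G else 0)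
      = (\<Sum>G\<in>{G \<in> Pow (P - M). T \<subseteq> G \<union> M}. (1 - q) * ?w G)"
    using fin by (rule sum.inter_filter[symmetric])
  also have "\<dots> = (\<Sum>G\<in>Pow (P - (M \<union> T)). (1 - q) * ?w (G \<union> (T - M)))"
  proof (rule sum.reindex_bij_witness[of _ "\<lambda>G. G \<union> (T - M)" "\<lambda>G. G - T"])
    fix G assume G: "G \<in> {G \<in> Pow (P - M). T \<subseteq> G \<union> M}"
    then show *: "G - T \<union> (T - M) = G" by auto
    show "G - T \<in> Pow (P - (M \<union> T))" using G by auto
    show "(1 - q) * ?w (G - T \<union> (T - M)) = (1 - q) * ?w G" by (simp only: *)
  qed (use assms(3) in auto)
  also have "\<dots> = (1 - q) * l ^ card (T - M) * Z l (M \<union> T) (H - {T})"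
    unfolding Z_def sum_distrib_left
  proof (intro sum.cong refl)
    fix G assume G: "G \<in> Pow (P - (M \<union> T))"
    have "finite G" "finite (T - M)"
      using G assms(3) finite_sites finite_subset[of _ P] by auto
    moreover have "G \<inter> (T - M) = {}" using G by auto
    ultimately have "card (G \<union> (T - M)) = card G + card (T - M)" by (rule card_Un_disjoint)
    moreover have "G \<union> (T - M) \<union> M = G \<union> (M \<union> T)" by auto
    ultimately show "(1 - q) * ?w (G \<union> (T - M)) = (1 - q) * l ^ card (T - M) *
        (l ^ card G * q ^ card {U \<in> H - {T}. U \<subseteq> G \<union> (M \<union> T)})"
      by (simp add: power_add)
  qed
  finally show ?thesis .
qed

text \<open>Differentiating l^|G| gives |G| l^(|G| - 1), and |G| counts the sites of
  \<open>G\<close>; exchanging the sums makes the logarithmic derivative a sum of site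
  marginals.\<close>

lemma has_derivative_Z:
  "((\<lambda>l. Z l {} H) has_real_derivative (\<Sum>e\<in>P. Z l {e} H)) (at l)"
proof -
  let ?w = "\<lambda>G. q ^ card {T \<in> H. T \<subseteq> G}"
  have Zw: "Z l {e} H = (\<Sum>G\<in>{G\<in>Pow P. e \<in> G}. l ^ (card G - 1) * ?w G)" if "e \<in> P" for e
    unfolding Z_def
  proof (rule sum.reindex_bij_witness[of _ "\<lambda>G. G - {e}" "insert e"])
    fix G assume G: "G \<in> Pow (P - {e})"
    then have "finite G" using finite_sites finite_subset[of G P] by auto
    then show "l ^ (card (insert e G) - 1) * ?w (insert e G) = l ^ card G * q ^ card {T \<in> H. T \<subseteq> G \<union> {e}}"
      using G by (subst card_insert_disjoint) auto
  qed (use that in auto)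
  have "(\<Sum>e\<in>P. Z l {e} H) = (\<Sum>e\<in>P. \<Sum>G\<in>Pow P. if e \<in> G then l ^ (card G - 1) * ?w G else 0)"
    using finite_sites by (intro sum.cong refl) (simp only: Zw sum.inter_filter finite_Pow_iff)
  also have "\<dots> = (\<Sum>G\<in>Pow P. \<Sum>e\<in>P. if e \<in> G then l ^ (card G - 1) * ?w G else 0)"
    by (rule sum.swap)
  also have "\<dots> = (\<Sum>G\<in>Pow P. real (card G) * l ^ (card G - 1) * ?w G)"
  proof (intro sum.cong refl)
    fix G assume "G \<in> Pow P"
    then have "{e \<in> P. e \<in> G} = G" by auto
    then show "(\<Sum>e\<in>P. if e \<in> G then l ^ (card G - 1) * ?w G else 0) = real (card G) * l ^ (card G - 1) * ?w G"
      using finite_sites by (simp flip: sum.inter_filter)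
  qed
  finally have *: "(\<Sum>e\<in>P. Z l {e} H) = (\<Sum>G\<in>Pow P. real (card G) * l ^ (card G - 1) * ?w G)" .
  show ?thesis unfolding * unfolding Z_def
    by (auto intro!: derivative_eq_intros sum.cong)
qed

end

section \<open>Triangles in the complete graph\<close>

text \<open>Telescoping over the elements of \<open>W\<close>. The ratio bounds are uniform in the
  subset already inserted, so the order of insertion is immaterial.\<close>

lemma iterated_ratio_bounds:
  fixes g :: "'a set \<Rightarrow> real" and lo hi :: "'a \<Rightarrow> real"
  assumes "finite W"
    and lo: "\<And>w W'. w \<in> W \<Longrightarrow> W' \<subseteq> W - {w} \<Longrightarrow> lo w * g W' \<le> g (insert w W')"
    and hi: "\<And>w W'. w \<in> W \<Longrightarrow> W' \<subseteq> W - {w} \<Longrightarrow> g (insert w W') \<le> hi w * g W'"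
    and nonneg: "\<And>w. w \<in> W \<Longrightarrow> 0 \<le> lo w" "\<And>w. w \<in> W \<Longrightarrow> 0 \<le> hi w"
  shows "prod lo W * g {} \<le> g W" "g W \<le> prod hi W * g {}"
proof -
  have "prod lo V * g {} \<le> g V \<and> g V \<le> prod hi V * g {}" if "V \<subseteq> W" for V
    using finite_subset[OF that \<open>finite W\<close>] that
  proof (induction V rule: finite_induct)
    case (insert w V)
    then have w: "w \<in> W" "V \<subseteq> W - {w}" by auto
    have "prod lo (insert w V) * g {} = lo w * (prod lo V * g {})"
      using insert by (simp add: mult.assoc)
    also have "\<dots> \<le> lo w * g V"
      using insert w nonneg by (intro mult_left_mono) auto
    also have "\<dots> \<le> g (insert w V)" using w lo by blast
    finally have 1: "prod lo (insert w V) * g {} \<le> g (insert w V)" .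
    have "g (insert w V) \<le> hi w * g V" using w hi by blast
    also have "\<dots> \<le> hi w * (prod hi V * g {})"
      using insert w nonneg by (intro mult_left_mono) auto
    also have "\<dots> = prod hi (insert w V) * g {}"
      using insert by (simp add: mult.assoc)
    finally show ?case using 1 by blast
  qed auto
  then show "prod lo W * g {} \<le> g W" "g W \<le> prod hi W * g {}" by auto
qed

definition tri :: "'a \<Rightarrow> 'a \<Rightarrow> 'a \<Rightarrow> 'a set set" where
  "tri u v w = {{u, v}, {u, w}, {v, w}}"

text \<open>Triangles as sets of three edges, which makes them hyperedges over the sites
  \<open>nsets {..<n} 2\<close>. They correspond to the vertex triples of
  \<open>triangle_count\<close> by \<open>inj_on_nsets_2\<close>.\<close>

definition triangles :: "nat \<Rightarrow> nat set set set" where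
  "triangles n = (\<lambda>T. nsets T 2) ` nsets {..<n} 3"

lemma tri_commute: "tri u v w = tri v u w"
  by (auto simp: tri_def)

lemma tri_rotate: "tri u v w = tri v w u"
  by (auto simp: tri_def)

lemma nsets_tri:
  assumes "u \<noteq> v" "u \<noteq> w" "v \<noteq> w"
  shows "nsets {u, v, w} 2 = tri u v w"
  using assms by (auto simp: nsets_2_eq tri_def)

lemma triangles_eq:
  "triangles n = {tri u v w | u v w. u < n \<and> v < n \<and> w < n \<and> u \<noteq> v \<and> u \<noteq> w \<and> v \<noteq> w}"
  unfolding triangles_def nsets_3_eq
proof (intro equalityI subsetI)
  fix x assume "x \<in> (\<lambda>T. nsets T 2) ` (\<Union>x\<in>{..<n}. \<Union>y\<in>{..<n} - {x}. \<Union>z\<in>{..<n} - {x, y}. {{x, y, z}})"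
  then obtain u v w where "u < n" "v < n" "w < n" "u \<noteq> v" "u \<noteq> w" "v \<noteq> w" "x = nsets {u, v, w} 2"
    by fastforce
  then show "x \<in> {tri u v w | u v w. u < n \<and> v < n \<and> w < n \<and> u \<noteq> v \<and> u \<noteq> w \<and> v \<noteq> w}"
    using nsets_tri[of u v w] by blast
next
  fix x assume "x \<in> {tri u v w | u v w. u < n \<and> v < n \<and> w < n \<and> u \<noteq> v \<and> u \<noteq> w \<and> v \<noteq> w}"
  then obtain u v w where *: "u < n" "v < n" "w < n" "u \<noteq> v" "u \<noteq> w" "v \<noteq> w" "x = tri u v w"
    by blast
  then have "x = nsets {u, v, w} 2" using nsets_tri[of u v w] by simp
  then show "x \<in> (\<lambda>T. nsets T 2) ` (\<Union>x\<in>{..<n}. \<Union>y\<in>{..<n} - {x}. \<Union>z\<in>{..<n} - {x, y}. {{x, y, z}})"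
    using * by fastforce
qed

lemma finite_triangles [simp]: "finite (triangles n)"
  unfolding triangles_def by (intro finite_imageI finite_imp_finite_nsets) auto

lemma triangle_subset: "T \<in> triangles n \<Longrightarrow> T \<subseteq> nsets {..<n} 2"
  unfolding triangles_eq by (auto simp: tri_def)

lemma triangle_through_edge:
  assumes "T \<in> triangles n" "{u, v} \<in> T" "u \<noteq> v"
  obtains w where "w < n" "w \<noteq> u" "w \<noteq> v" "T = tri u v w"
proof -
  from assms(1) obtain a b c where *: "a < n" "b < n" "c < n" "a \<noteq> b" "a \<noteq> c" "b \<noteq> c" "T = tri a b c"
    unfolding triangles_eq by blast
  from assms(2) have "{u, v} = {a, b} \<or> {u, v} = {a, c} \<or> {u, v} = {b, c}"
    unfolding * by (auto simp: tri_def)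
  then have "T = tri u v c \<and> c \<noteq> u \<and> c \<noteq> v \<or> T = tri u v b \<and> b \<noteq> u \<and> b \<noteq> v \<or> T = tri u v a \<and> a \<noteq> u \<and> a \<noteq> v"
    unfolding doubleton_eq_iff using * tri_commute tri_rotate by metis
  with * that show thesis by blast
qed

lemma tri_in_triangles:
  "u < n \<Longrightarrow> v < n \<Longrightarrow> w < n \<Longrightarrow> u \<noteq> v \<Longrightarrow> u \<noteq> w \<Longrightarrow> v \<noteq> w \<Longrightarrow> tri u v w \<in> triangles n"
  unfolding triangles_eq by blast

lemma inj_on_tri: "inj_on (tri u v) (- {u, v})"
proof (rule inj_onI)
  fix w w' assume w: "w \<in> - {u, v}" "w' \<in> - {u, v}" "tri u v w = tri u v w'"
  have "{u, w} \<in> tri u v w" by (simp add: tri_def)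
  then have "{u, w} = {u, v} \<or> {u, w} = {u, w'} \<or> {u, w} = {v, w'}"
    unfolding w(3) by (simp add: tri_def)
  then show "w = w'" using w(1,2) unfolding doubleton_eq_iff by blast
qed

text \<open>The vertex set of a triangle is the union of its edges.\<close>

lemma inj_on_nsets_2: "inj_on (\<lambda>T. nsets T 2) (nsets A 3)"
proof (rule inj_on_inverseI[of _ Union])
  fix T assume "T \<in> nsets A 3"
  then obtain u v w where "T = {u, v, w}" "u \<noteq> v" "u \<noteq> w" "v \<noteq> w"
    unfolding nsets_3_eq by blast
  then show "\<Union> (nsets T 2) = T" by (auto simp: nsets_tri tri_def)
qed

lemma triangle_count_eq: "triangle_count n E = card {T \<in> triangles n. T \<subseteq> E}"
proof -
  have "{T \<in> triangles n. T \<subseteq> E} = (\<lambda>T. nsets T 2) ` {T \<in> nsets {..<n} 3. nsets T 2 \<subseteq> E}"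
    unfolding triangles_def by auto
  moreover have "inj_on (\<lambda>T. nsets T 2) {T \<in> nsets {..<n} 3. nsets T 2 \<subseteq> E}"
    by (rule inj_on_subset[OF inj_on_nsets_2]) auto
  ultimately show ?thesis unfolding triangle_count_def by (simp add: card_image)
qed

lemma card_nsets_lessThan: "card (nsets {..<n} k) = n choose k"
  unfolding lessThan_atLeast0 binomial_eq_nsets ..

lemma card_triangles: "card (triangles n) = n choose 3"
  unfolding triangles_def by (simp add: card_image inj_on_nsets_2 card_nsets_lessThan)

section \<open>Edge marginals of the triangle gas and their recursion\<close>

locale triangle_gas = hypergraph_gas "nsets {..<n} 2" q for n :: nat and q :: real
begin

abbreviation "pairs \<equiv> nsets {..<n} 2"

text \<open>By \<open>Z_site\<close>, \<open>l * rho l M H e\<close> is the conditional probability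
  that \<open>e\<close> is present. Without the factor \<open>l\<close> the quantity stays of order
  1 as \<open>l\<close> tends to 0.\<close>

definition rho :: "real \<Rightarrow> nat set set \<Rightarrow> nat set set set \<Rightarrow> nat set \<Rightarrow> real" where
  "rho l M H e = Z l (insert e M) H / Z l M H"

text \<open>
  The last condition excludes hyperedges that would be fully present once \<open>e\<close> is: such a
  hyperedge contributes a factor \<open>q\<close>, which is not close to \<open>1\<close>.
\<close>

definition admissible :: "nat \<Rightarrow> nat set set \<Rightarrow> nat set set set \<Rightarrow> nat set \<Rightarrow> bool" where
  "admissible m M H e \<longleftrightarrow> M \<subseteq> pairs \<and> card M \<le> m \<and> e \<in> pairs - M \<and> H \<subseteq> triangles n \<and>
     (\<forall>T\<in>triangles n. T \<inter> M = {} \<longrightarrow> T \<in> H) \<and> (\<forall>T\<in>H. e \<in> T \<longrightarrow> \<not> T \<subseteq> insert e M)"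

lemma admissibleD:
  assumes "admissible m M H e"
  shows "M \<subseteq> pairs" "card M \<le> m" "e \<in> pairs - M" "H \<subseteq> triangles n"
    "T \<in> triangles n \<Longrightarrow> T \<inter> M = {} \<Longrightarrow> T \<in> H"
    "T \<in> H \<Longrightarrow> e \<in> T \<Longrightarrow> \<not> T \<subseteq> insert e M"
proof -
  note adm = assms[unfolded admissible_def]
  from adm show "M \<subseteq> pairs" by (elim conjE)
  from adm show "card M \<le> m" by (elim conjE)
  from adm show "e \<in> pairs - M" by (elim conjE)
  from adm show "H \<subseteq> triangles n" by (elim conjE)
  from adm have "\<forall>T\<in>triangles n. T \<inter> M = {} \<longrightarrow> T \<in> H" by (elim conjE)
  then show "T \<in> triangles n \<Longrightarrow> T \<inter> M = {} \<Longrightarrow> T \<in> H" by metis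
  from adm have "\<forall>T\<in>H. e \<in> T \<longrightarrow> \<not> T \<subseteq> insert e M" by (elim conjE)
  then show "T \<in> H \<Longrightarrow> e \<in> T \<Longrightarrow> \<not> T \<subseteq> insert e M" by metis
qed

lemma admissible_mono: "admissible m M H e \<Longrightarrow> m \<le> m' \<Longrightarrow> admissible m' M H e"
  unfolding admissible_def by (elim conjE, intro conjI) simp_all

lemma rho_nonneg: "0 \<le> l \<Longrightarrow> 0 \<le> rho l M H e"
  unfolding rho_def by (simp add: Z_pos less_imp_le)

lemma rho_le_1:
  assumes "0 \<le> l" "admissible m M H e"
  shows "rho l M H e \<le> 1"
proof -
  have "finite H" using admissibleD(4)[OF assms(2)] by (rule finite_subset) simp
  then have "Z l (insert e M) H \<le> Z l M H"
    using admissibleD(3)[OF assms(2)] by (intro Z_insert_le assms)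
  then show ?thesis unfolding rho_def using Z_pos[OF assms(1), of M H] by simp
qed

text \<open>One step of the recursion. A vertex untouched by \<open>M\<close> contributes a factor
  between 1 - z l^2 b^2 and 1 - z l^2 a^2; the at most 2 m vertices met by \<open>M\<close>
  contribute factors between 1 - z l and 1, which are harmless in the limit. The hypothesis is for
  \<open>m + 2\<close> because \<open>e\<close> and one edge at the new vertex join \<open>M\<close>
  before the second edge is tested.\<close>

lemma rho_step:
  assumes l: "0 \<le> l" "l \<le> 1"
    and rec: "\<And>M H f. admissible (m + 2) M H f \<Longrightarrow> a \<le> rho l M H f \<and> rho l M H f \<le> b"
    and ab: "0 \<le> a" "b \<le> 1"
    and adm: "admissible m M H e"
  shows "rho l M H e \<le> (1 - (1 - q) * l\<^sup>2 * a\<^sup>2) ^ (n - 2 - 2 * m)"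
    and "(1 - (1 - q) * l\<^sup>2 * b\<^sup>2) ^ n * (1 - (1 - q) * l) ^ (2 * m) / (1 + l) \<le> rho l M H e"
proof -
  note D = admissibleD[OF adm]
  have M: "M \<subseteq> pairs" "card M \<le> m" "e \<in> pairs" "e \<notin> M" and H: "H \<subseteq> triangles n"
    using D(1-4) by simp_all
  note undamaged = D(5) and notfull = D(6)
  have adm2: "admissible (m + 2) M H e" using adm by (rule admissible_mono) simp
  have finM: "finite M" using M(1) finite_sites finite_subset by blast
  have finH: "finite H" using H finite_triangles finite_subset by blast
  obtain u v where e: "e = {u, v}" "u < n" "v < n" "u \<noteq> v"
    using M(3) by (auto simp: nsets_2_eq)
  define z where "z = 1 - q"
  have z: "0 \<le> z" "z < 1" using q_pos q_le_1 unfolding z_def by auto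
  define H0 where "H0 = {T \<in> H. e \<notin> T}"
  define W where "W = {w. w < n \<and> w \<noteq> u \<and> w \<noteq> v \<and> tri u v w \<in> H}"
  define W1 where "W1 = {..<n} - {u, v} - \<Union>M"
  \<comment> \<open>\<open>g\<close> switches on the triangles over \<open>e\<close> one vertex at a
    time, with \<open>e\<close> declared present: \<open>g {}\<close> is the weight of
    \<open>e\<close> absent, \<open>g W\<close> that of \<open>e\<close> present up to the factor
    \<open>l\<close>.\<close>
  define g where "g V = Z l (insert e M) (H0 \<union> tri u v ` V)" for V
  have finW: "finite W" "finite W1" unfolding W_def W1_def by auto
  have edges: "{u, w} \<in> pairs" "{v, w} \<in> pairs" if "w \<in> W" for w
    using that e unfolding W_def by auto
  have W1W: "W1 \<subseteq> W"
  proof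
    fix w assume w: "w \<in> W1"
    then have "tri u v w \<inter> M = {}" using M(4) e unfolding W1_def tri_def by auto
    moreover have "tri u v w \<in> triangles n"
      using w e unfolding W1_def by (intro tri_in_triangles) auto
    ultimately show "w \<in> W" using undamaged w unfolding W_def W1_def by auto
  qed
  have HW: "H = H0 \<union> tri u v ` W"
  proof (intro equalityI subsetI)
    fix T assume T: "T \<in> H"
    show "T \<in> H0 \<union> tri u v ` W"
    proof (cases "e \<in> T")
      case True
      with T H e obtain w where "w < n" "w \<noteq> u" "w \<noteq> v" "T = tri u v w"
        using triangle_through_edge[of T n u v] by blast
      with T show ?thesis unfolding W_def by auto
    qed (use T in \<open>auto simp: H0_def\<close>)
  qed (auto simp: H0_def W_def)
  have cardU: "card (\<Union>M) \<le> 2 * m"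
  proof -
    have "card (\<Union>M) \<le> sum card M" by (rule card_Union_le_sum_card)
    also have "\<dots> = (\<Sum>x\<in>M. 2)" using M(1) by (intro sum.cong) (auto simp: nsets_def)
    finally show ?thesis using M(2) by simp
  qed
  have finU: "finite (\<Union>M)" using M(1) finM by (auto simp: nsets_def)
  have card1: "n - 2 - 2 * m \<le> card W1" "card W1 \<le> n"
  proof -
    have "card ({..<n} - {u, v}) = n - 2" using e by (subst card_Diff_subset) auto
    moreover have "card ({..<n} - {u, v}) - card (\<Union>M) \<le> card W1"
      unfolding W1_def using finU by (intro diff_card_le_card_Diff)
    ultimately show "n - 2 - 2 * m \<le> card W1" using cardU by linarith
    have "card W1 \<le> card {..<n}" unfolding W1_def by (intro card_mono) auto
    then show "card W1 \<le> n" by simp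
  qed
  have card2: "card (W - W1) \<le> 2 * m"
  proof -
    have "W - W1 \<subseteq> \<Union>M" unfolding W_def W1_def by auto
    then have "card (W - W1) \<le> card (\<Union>M)" using finU by (intro card_mono)
    with cardU show ?thesis by simp
  qed
  have gpos: "0 < g V" for V unfolding g_def by (intro Z_pos l)
  have b0: "0 \<le> b" using rec[OF adm2] rho_nonneg[OF l(1), of M H e] by linarith
  have a1: "a \<le> 1" using rec[OF adm2] rho_le_1[OF l(1) adm2] by linarith
  have l2: "l\<^sup>2 \<le> 1" using l by (simp add: power_le_one)
  have small: "z * l\<^sup>2 * x\<^sup>2 \<le> 1" if "0 \<le> x" "x \<le> 1" for x
    using that z l l2 by (intro mult_le_one mult_nonneg_nonneg) (auto simp: power_le_one)
  define hi where "hi w = (if w \<in> W1 then 1 - z * l\<^sup>2 * a\<^sup>2 else 1)" for w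
  define lo where "lo w = (if w \<in> W1 then 1 - z * l\<^sup>2 * b\<^sup>2 else 1 - z * l)" for w
  have step: "lo w * g V \<le> g (insert w V) \<and> g (insert w V) \<le> hi w * g V"
    if wV: "w \<in> W" "V \<subseteq> W - {w}" for w V
  proof -
    let ?T = "tri u v w" and ?M = "insert e M" and ?H = "H0 \<union> tri u v ` V"
    have w: "w < n" "w \<noteq> u" "w \<noteq> v" "?T \<in> H" using wV unfolding W_def by auto
    have T_notin: "?T \<notin> ?H"
    proof -
      have "e \<in> ?T" unfolding e tri_def by auto
      moreover have "?T \<notin> tri u v ` V"
      proof
        assume "?T \<in> tri u v ` V"
        then obtain w' where w': "w' \<in> V" "?T = tri u v w'" by blast
        then have "w' \<in> - {u, v}" "w' \<noteq> w" using wV(2) unfolding W_def by blast+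
        then show False using inj_onD[OF inj_on_tri w'(2)] w by simp
      qed
      ultimately show ?thesis unfolding H0_def by blast
    qed
    have HH: "?H \<subseteq> H" using wV unfolding H0_def W_def by blast
    have finHH: "finite ?H" using HH finH finite_subset by blast
    have Tsub: "?T \<subseteq> pairs" using w H triangle_subset by blast
    have "H0 \<union> tri u v ` insert w V - {?T} = ?H" using T_notin by blast
    moreover have "finite (H0 \<union> tri u v ` insert w V)" using finHH by simp
    moreover have "?T - ?M \<subseteq> pairs" using Tsub by blast
    ultimately have eq: "g (insert w V) = g V - z * l ^ card (?T - ?M) * Z l (?M \<union> ?T) ?H"
      using Z_hyperedge[of ?T "H0 \<union> tri u v ` insert w V" ?M l]
      unfolding g_def z_def by simp
    show ?thesis
    proof (cases "w \<in> W1")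
      case True
      let ?f = "{u, w}" and ?g = "{v, w}"
      have fresh: "{w, x} \<notin> M" for x using True unfolding W1_def by auto
      have fg: "?f \<notin> ?M" "?g \<notin> insert ?f ?M" "?f \<noteq> ?g"
        using fresh[of u] fresh[of v] w e by (simp_all add: insert_commute[of w] doubleton_eq_iff)
      have undam: "T' \<in> ?H" if "T' \<in> triangles n" "T' \<inter> ?M = {}" for T'
        using undamaged[of T'] that unfolding H0_def by blast
      have cM: "card ?M \<le> m + 1" "card (insert ?f ?M) \<le> m + 2"
        using M(2) finM by (auto simp: card_insert_if)
      \<comment> \<open>A triangle through uw has a further edge wy at the fresh vertex w. That edge
        lies outside \<open>M\<close> and differs from both uv and uw, so adding uw cannot complete
        a penalised triangle.\<close>
      have adm_f: "admissible (m + 2) ?M ?H ?f"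
        unfolding admissible_def
      proof (intro conjI ballI impI)
        show "?f \<in> pairs - ?M" using edges[OF wV(1)] fg by auto
        fix T' assume T': "T' \<in> ?H" "?f \<in> T'"
        then obtain y where y: "y < n" "y \<noteq> u" "y \<noteq> w" "T' = tri u w y"
          using HH H w triangle_through_edge[of T' n u w] by (metis subsetD)
        have "{w, y} \<notin> insert ?f ?M"
          using fresh[of y] w y e by (simp add: doubleton_eq_iff)
        moreover have "{w, y} \<in> T'" using y by (simp add: tri_def)
        ultimately show "\<not> T' \<subseteq> insert ?f ?M" by blast
      next
        show "?M \<subseteq> pairs" using M by simp
        show "card ?M \<le> m + 2" using cM by simp
        show "?H \<subseteq> triangles n" using HH H by (rule subset_trans)
      qed (rule undam)
      have adm_g: "admissible (m + 2) (insert ?f ?M) ?H ?g"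
        unfolding admissible_def
      proof (intro conjI ballI impI)
        show "?g \<in> pairs - insert ?f ?M" using edges[OF wV(1)] fg by auto
        fix T' assume T': "T' \<in> ?H" "?g \<in> T'"
        then obtain y where y: "y < n" "y \<noteq> v" "y \<noteq> w" "T' = tri v w y"
          using HH H w triangle_through_edge[of T' n v w] by (metis subsetD)
        \<comment> \<open>With uv and uw already present, vw would complete the triangle uvw. It is
          harmless here because the telescoping has not switched it on yet.\<close>
        have "y \<noteq> u"
        proof
          assume "y = u"
          then have "T' = ?T" using y tri_rotate[of u v w] by simp
          then show False using T' T_notin by simp
        qed
        then have "{w, y} \<notin> insert ?g (insert ?f ?M)"
          using fresh[of y] w y e by (simp add: doubleton_eq_iff)
        moreover have "{w, y} \<in> T'" using y by (simp add: tri_def)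
        ultimately show "\<not> T' \<subseteq> insert ?g (insert ?f ?M)" by blast
      next
        show "insert ?f ?M \<subseteq> pairs" using M edges[OF wV(1)] by simp
        show "card (insert ?f ?M) \<le> m + 2" by (rule cM)
        show "?H \<subseteq> triangles n" using HH H by (rule subset_trans)
        fix T' assume "T' \<in> triangles n" "T' \<inter> insert ?f ?M = {}"
        then show "T' \<in> ?H" by (intro undam) simp_all
      qed
      have "?T - ?M = {?f, ?g}" using fg e unfolding tri_def by blast
      then have c2: "card (?T - ?M) = 2" using fg by simp
      have "?M \<union> ?T = insert ?g (insert ?f ?M)" using e unfolding tri_def by blast
      \<comment> \<open>Chain rule for conditional probabilities: the two missing edges of the
        triangle are added one after the other.\<close>
      then have "Z l (?M \<union> ?T) ?H = rho l ?M ?H ?f * rho l (insert ?f ?M) ?H ?g * g V"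
        using Z_pos[OF l(1), of ?M ?H] Z_pos[OF l(1), of "insert ?f ?M" ?H]
        unfolding rho_def g_def by simp
      then have eq2: "g (insert w V) = (1 - z * l\<^sup>2 * (rho l ?M ?H ?f * rho l (insert ?f ?M) ?H ?g)) * g V"
        unfolding eq c2 by (simp add: algebra_simps)
      have rr: "a\<^sup>2 \<le> rho l ?M ?H ?f * rho l (insert ?f ?M) ?H ?g"
        "rho l ?M ?H ?f * rho l (insert ?f ?M) ?H ?g \<le> b\<^sup>2"
        unfolding power2_eq_square using rec[OF adm_f] rec[OF adm_g] ab b0
        by (auto intro!: mult_mono)
      have "lo w \<le> 1 - z * l\<^sup>2 * (rho l ?M ?H ?f * rho l (insert ?f ?M) ?H ?g)"
        "1 - z * l\<^sup>2 * (rho l ?M ?H ?f * rho l (insert ?f ?M) ?H ?g) \<le> hi w"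
        using True rr z unfolding lo_def hi_def by (auto intro!: mult_left_mono)
      then show ?thesis unfolding eq2 using gpos[of V] by (auto intro!: mult_right_mono)
    next
      case False
      \<comment> \<open>At a vertex met by \<open>M\<close>, admissibility still leaves at least one
        edge of the triangle undetermined. It supplies one factor \<open>l\<close>, enough for the
        ratio bound 1 - z l.\<close>
      have "\<not> ?T \<subseteq> ?M" using notfull[of ?T] w e by (simp add: tri_def)
      moreover have "finite (?T - ?M)" by (auto simp: tri_def)
      ultimately have "card (?T - ?M) \<noteq> 0" by auto
      then have "l ^ card (?T - ?M) \<le> l" using l power_decreasing[of 1 "card (?T - ?M)" l] by simp
      moreover have "Z l (?M \<union> ?T) ?H \<le> g V"
        unfolding g_def using l finHH Tsub by (intro Z_union_le)
      ultimately have "z * (l ^ card (?T - ?M) * Z l (?M \<union> ?T) ?H) \<le> z * (l * g V)"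
        using z l less_imp_le[OF Z_pos[OF l(1)]] by (intro mult_left_mono mult_mono) auto
      moreover have "0 \<le> z * (l ^ card (?T - ?M) * Z l (?M \<union> ?T) ?H)"
        using z l less_imp_le[OF Z_pos[OF l(1)]] by (intro mult_nonneg_nonneg) auto
      ultimately show ?thesis unfolding eq lo_def hi_def using False by (simp add: algebra_simps)
    qed
  qed
  have zl: "z * l \<le> 1" using z l by (intro mult_le_one) auto
  have lohi: "0 \<le> lo w" "0 \<le> hi w" for w
    using small[of a] small[of b] ab a1 b0 zl unfolding lo_def hi_def by auto
  have iter: "prod lo W * g {} \<le> g W" "g W \<le> prod hi W * g {}"
    using iterated_ratio_bounds[of W lo g hi] finW step lohi by blast+
  have W: "W = W1 \<union> (W - W1)" using W1W by auto
  have prod_split: "prod h W = prod h W1 * prod h (W - W1)" for h :: "nat \<Rightarrow> real"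
    by (subst W, rule prod.union_disjoint) (use finW in auto)
  have hiW: "prod hi W \<le> (1 - z * l\<^sup>2 * a\<^sup>2) ^ (n - 2 - 2 * m)"
  proof -
    have "prod hi W = (1 - z * l\<^sup>2 * a\<^sup>2) ^ card W1"
      unfolding prod_split by (simp add: hi_def)
    also have "\<dots> \<le> (1 - z * l\<^sup>2 * a\<^sup>2) ^ (n - 2 - 2 * m)"
      using card1 small[of a] ab a1 z l by (intro power_decreasing) auto
    finally show ?thesis .
  qed
  have loW: "(1 - z * l\<^sup>2 * b\<^sup>2) ^ n * (1 - z * l) ^ (2 * m) \<le> prod lo W"
  proof -
    have "(1 - z * l\<^sup>2 * b\<^sup>2) ^ n \<le> (1 - z * l\<^sup>2 * b\<^sup>2) ^ card W1"
      using card1 small[of b] ab b0 z l by (intro power_decreasing) auto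
    moreover have "(1 - z * l) ^ (2 * m) \<le> (1 - z * l) ^ card (W - W1)"
      using card2 zl z l by (intro power_decreasing) auto
    ultimately have "(1 - z * l\<^sup>2 * b\<^sup>2) ^ n * (1 - z * l) ^ (2 * m)
        \<le> (1 - z * l\<^sup>2 * b\<^sup>2) ^ card W1 * (1 - z * l) ^ card (W - W1)"
      using small[of b] ab b0 zl by (intro mult_mono) auto
    also have "\<dots> = prod lo W" unfolding prod_split by (simp add: lo_def)
    finally show ?thesis .
  qed
  have gW: "g W = Z l (insert e M) H" unfolding g_def using HW by simp
  have g0: "g {} = Z l (insert e M) H0" unfolding g_def by simp
  \<comment> \<open>Dropping \<open>l * g W\<close> from the denominator gives the upper bound. The
    lower bound replaces \<open>g W\<close> there by the larger \<open>g {}\<close>, at the price of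
    the factor 1 / (1 + l).\<close>
  have rho: "rho l M H e = g W / (g {} + l * g W)"
    unfolding rho_def gW g0 H0_def using Z_site[of e M l H] M by auto
  have ge: "g {} \<le> g {} + l * g W" using l gpos[of W] by (simp add: less_imp_le)
  have "rho l M H e \<le> g W / g {}"
    unfolding rho using gpos[of W] gpos[of "{}"] ge by (intro divide_left_mono) (auto intro!: mult_pos_pos)
  also have "\<dots> \<le> prod hi W" using iter gpos[of "{}"] by (simp add: divide_le_eq)
  also note hiW
  finally show "rho l M H e \<le> (1 - (1 - q) * l\<^sup>2 * a\<^sup>2) ^ (n - 2 - 2 * m)" unfolding z_def .
  have "g W \<le> g {}"
    unfolding gW g0 H0_def using finH l by (intro Z_mono) auto
  then have "g {} + l * g W \<le> (1 + l) * g {}" using l by (simp add: algebra_simps mult_left_mono)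
  then have "g W / ((1 + l) * g {}) \<le> rho l M H e"
    unfolding rho using gpos[of W] gpos[of "{}"] l
    by (intro divide_left_mono) (auto intro!: mult_pos_pos add_pos_nonneg)
  moreover have "prod lo W / (1 + l) \<le> g W / ((1 + l) * g {})"
  proof -
    have "prod lo W \<le> g W / g {}" using iter gpos[of "{}"] by (simp add: le_divide_eq)
    then have "prod lo W / (1 + l) \<le> g W / g {} / (1 + l)" using l by (intro divide_right_mono) auto
    then show ?thesis by (simp add: mult.commute)
  qed
  moreover have "(1 - z * l\<^sup>2 * b\<^sup>2) ^ n * (1 - z * l) ^ (2 * m) / (1 + l) \<le> prod lo W / (1 + l)"
    using loW l by (intro divide_right_mono) auto
  ultimately show "(1 - (1 - q) * l\<^sup>2 * b\<^sup>2) ^ n * (1 - (1 - q) * l) ^ (2 * m) / (1 + l) \<le> rho l M H e"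
    unfolding z_def by linarith
qed

end

section \<open>Convergence of the edge marginals\<close>

text \<open>Compare N ln (1 - x) with - N x: the error is of order N x^2, that is, the convergent
  sequence N x times the null sequence x.\<close>

lemma tendsto_power_exp:
  fixes x :: "nat \<Rightarrow> real" and N :: "nat \<Rightarrow> nat"
  assumes x: "x \<longlonglongrightarrow> 0" and Nx: "(\<lambda>n. real (N n) * x n) \<longlonglongrightarrow> a"
  shows "(\<lambda>n. (1 - x n) ^ N n) \<longlonglongrightarrow> exp (- a)"
proof -
  have small: "\<forall>\<^sub>F n in sequentially. \<bar>x n\<bar> < 1/2"
    using tendsto_rabs_zero[OF x] by (rule order_tendstoD) simp
  have "(\<lambda>n. real (N n) * (ln (1 - x n) + x n)) \<longlonglongrightarrow> 0"
  proof (rule Lim_null_comparison)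
    show "\<forall>\<^sub>F n in sequentially. norm (real (N n) * (ln (1 - x n) + x n)) \<le> 2 * \<bar>real (N n) * x n\<bar> * \<bar>x n\<bar>"
      using small
    proof eventually_elim
      case (elim n)
      have "\<bar>ln (1 + (- x n)) - (- x n)\<bar> \<le> 2 * (- x n)\<^sup>2"
        using elim by (intro abs_ln_one_plus_x_minus_x_bound) auto
      then have "real (N n) * \<bar>ln (1 - x n) + x n\<bar> \<le> real (N n) * (2 * (x n)\<^sup>2)"
        by (intro mult_left_mono) auto
      moreover have "norm (real (N n) * (ln (1 - x n) + x n)) = real (N n) * \<bar>ln (1 - x n) + x n\<bar>"
        by (simp add: abs_mult)
      moreover have "2 * \<bar>real (N n) * x n\<bar> * \<bar>x n\<bar> = real (N n) * (2 * (x n)\<^sup>2)"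
        by (simp add: abs_mult power2_eq_square)
      ultimately show ?case by linarith
    qed
    have "(\<lambda>n. 2 * \<bar>real (N n) * x n\<bar> * \<bar>x n\<bar>) \<longlonglongrightarrow> 2 * \<bar>a\<bar> * \<bar>0\<bar>"
      by (intro tendsto_intros Nx x)
    then show "(\<lambda>n. 2 * \<bar>real (N n) * x n\<bar> * \<bar>x n\<bar>) \<longlonglongrightarrow> 0" by simp
  qed
  from tendsto_diff[OF this Nx] have "(\<lambda>n. real (N n) * ln (1 - x n)) \<longlonglongrightarrow> - a"
    by (simp add: algebra_simps)
  then have "(\<lambda>n. exp (real (N n) * ln (1 - x n))) \<longlonglongrightarrow> exp (- a)" by (rule tendsto_exp)
  moreover have "\<forall>\<^sub>F n in sequentially. exp (real (N n) * ln (1 - x n)) = (1 - x n) ^ N n"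
    using small by eventually_elim (simp add: exp_of_nat_mult)
  ultimately show ?thesis by (rule Lim_transform_eventually)
qed

lemma tendsto_zero_of_sqrt_scaled:
  fixes L :: "nat \<Rightarrow> real"
  assumes "(\<lambda>n. sqrt (real n) * L n) \<longlonglongrightarrow> s"
  shows "L \<longlonglongrightarrow> 0"
proof -
  have "(\<lambda>n. sqrt (real n) * L n * inverse (sqrt (real n))) \<longlonglongrightarrow> s * 0"
  proof (intro tendsto_mult assms tendsto_inverse_0_at_top)
    show "filterlim (\<lambda>n. sqrt (real n)) at_top sequentially"
      by (rule filterlim_compose[OF sqrt_at_top filterlim_real_sequentially])
  qed
  moreover have "\<forall>\<^sub>F n in sequentially. sqrt (real n) * L n * inverse (sqrt (real n)) = L n"
    using eventually_gt_at_top[of 0] by eventually_elim (simp add: field_simps)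
  ultimately show ?thesis by (auto intro: Lim_transform_eventually)
qed

text \<open>The shift changes the product by a fixed multiple of (L n)^2, which vanishes. It absorbs
  the exponent \<open>n - 2 - 2 * m\<close> of \<open>rho_step\<close>; the truncation in
  \<open>n - c\<close> concerns only n < c.\<close>

lemma tendsto_shifted_square:
  fixes L :: "nat \<Rightarrow> real"
  assumes "(\<lambda>n. sqrt (real n) * L n) \<longlonglongrightarrow> s"
  shows "(\<lambda>n. real (n - c) * (L n)\<^sup>2) \<longlonglongrightarrow> s\<^sup>2"
proof -
  have "(\<lambda>n. (sqrt (real n) * L n)\<^sup>2 - real c * (L n)\<^sup>2) \<longlonglongrightarrow> s\<^sup>2 - real c * 0\<^sup>2"
    by (intro tendsto_intros assms tendsto_zero_of_sqrt_scaled[OF assms])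
  moreover have "\<forall>\<^sub>F n in sequentially. (sqrt (real n) * L n)\<^sup>2 - real c * (L n)\<^sup>2 = real (n - c) * (L n)\<^sup>2"
    using eventually_ge_at_top[of c]
    by eventually_elim (simp add: power_mult_distrib of_nat_diff algebra_simps)
  ultimately show ?thesis by (auto intro: Lim_transform_eventually)
qed

text \<open>exp (- x) is 1-Lipschitz for x >= 0, and |s^2 - t^2| <= 2 |s - t| on the unit interval.
  This is the source of the condition 2 a < 1.\<close>

lemma exp_neg_square_contraction:
  fixes a s t :: real
  assumes "0 \<le> a" "0 \<le> s" "s \<le> 1" "0 \<le> t" "t \<le> 1"
  shows "\<bar>exp (- (a * s\<^sup>2)) - exp (- (a * t\<^sup>2))\<bar> \<le> 2 * a * \<bar>s - t\<bar>"
proof -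
  have exp_diff: "\<bar>exp (- x) - exp (- y)\<bar> \<le> \<bar>x - y\<bar>" if "0 \<le> x" "x \<le> y" for x y :: real
  proof -
    have lin: "1 - exp (- (y - x)) \<le> y - x"
      using exp_ge_add_one_self[of "- (y - x)"] by linarith
    have "exp (- x) - exp (- y) = exp (- x) * (1 - exp (- (y - x)))"
      by (simp add: algebra_simps flip: exp_add)
    also have "\<dots> \<le> 1 * (y - x)"
      using that lin by (intro mult_mono) auto
    finally show ?thesis using that by simp
  qed
  have "\<bar>exp (- (a * s\<^sup>2)) - exp (- (a * t\<^sup>2))\<bar> \<le> \<bar>a * s\<^sup>2 - a * t\<^sup>2\<bar>"
    using exp_diff[of "a * s\<^sup>2" "a * t\<^sup>2"] exp_diff[of "a * t\<^sup>2" "a * s\<^sup>2"] assms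
    by (cases "a * s\<^sup>2 \<le> a * t\<^sup>2") (auto simp: abs_minus_commute)
  also have "a * s\<^sup>2 - a * t\<^sup>2 = a * (s + t) * (s - t)" by (simp add: power2_eq_square algebra_simps)
  also have "\<bar>\<dots>\<bar> = a * (s + t) * \<bar>s - t\<bar>" using assms by (simp add: abs_mult)
  also have "\<dots> \<le> a * 2 * \<bar>s - t\<bar>" using assms by (intro mult_right_mono mult_left_mono) auto
  finally show ?thesis by (simp add: mult.commute)
qed

text \<open>Entry point of the recursion: with nothing conditioned, a triangle through
  \<open>e\<close> always has an edge other than \<open>e\<close>.\<close>

lemma (in triangle_gas) admissible_start:
  assumes "e \<in> pairs"
  shows "admissible 0 {} (triangles n) e"
  unfolding admissible_def
proof (intro conjI ballI impI)
  fix T assume T: "T \<in> triangles n" "e \<in> T"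
  obtain u v where e: "e = {u, v}" "u \<noteq> v" using assms by (auto simp: nsets_2_eq)
  then obtain w where "w \<noteq> u" "w \<noteq> v" "T = tri u v w"
    using T triangle_through_edge[of T n u v] by blast
  then have "{u, w} \<in> T" "{u, w} \<noteq> e" using e by (simp_all add: tri_def doubleton_eq_iff)
  then show "\<not> T \<subseteq> {e}" by blast
qed (use assms in simp_all)

text \<open>
  The recursion maps bounds with limits \<open>\<alpha>\<close> and \<open>\<beta>\<close> to bounds with limits \<open>exp (- a \<beta>\<^sup>2)\<close> and
  \<open>exp (- a \<alpha>\<^sup>2)\<close>, and \<open>2 a < 1\<close> makes this map a contraction.
\<close>

lemma rho_bounds:
  fixes L :: "nat \<Rightarrow> real"
  assumes q: "0 < q" "q \<le> 1"
    and L0: "\<And>n. 0 \<le> L n" and L: "(\<lambda>n. sqrt (real n) * L n) \<longlonglongrightarrow> s"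
    and a: "a = (1 - q) * s\<^sup>2"
    and y: "y = exp (- (a * y\<^sup>2))"
  shows "\<exists>lo hi \<alpha> \<beta>. lo \<longlonglongrightarrow> \<alpha> \<and> hi \<longlonglongrightarrow> \<beta> \<and> \<alpha> \<in> {0..1} \<and> \<beta> \<in> {0..1} \<and>
     \<bar>\<alpha> - y\<bar> \<le> (2 * a) ^ k \<and> \<bar>\<beta> - y\<bar> \<le> (2 * a) ^ k \<and>
     (\<forall>n. L n \<le> 1 \<longrightarrow> lo n \<in> {0..1} \<and> hi n \<in> {0..1} \<and>
       (\<forall>M H e. triangle_gas.admissible n m M H e \<longrightarrow>
          lo n \<le> triangle_gas.rho n q (L n) M H e \<and> triangle_gas.rho n q (L n) M H e \<le> hi n))"
\<comment> \<open>\<open>m\<close> must vary: the bounds after k + 1 steps for \<open>m\<close>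
  conditioned edges come from the bounds after k steps for \<open>m + 2\<close>. The start is the
  trivial pair 0 and 1.\<close>
proof (induction k arbitrary: m)
  case 0
  have gas: "triangle_gas n q" for n
    by unfold_locales (use q in \<open>auto intro: finite_imp_finite_nsets\<close>)
  have "0 \<le> a" using q a by simp
  then have "exp (- (a * y\<^sup>2)) \<le> 1" by simp
  then have "0 \<le> y" "y \<le> 1" using y exp_ge_zero[of "- (a * y\<^sup>2)"] by linarith+
  then have y1: "\<bar>0 - y\<bar> \<le> 1" "\<bar>1 - y\<bar> \<le> 1" by auto
  show ?case
    by (rule exI[of _ "\<lambda>_. 0"], rule exI[of _ "\<lambda>_. 1"], rule exI[of _ 0], rule exI[of _ 1])
      (use y1 L0 triangle_gas.rho_nonneg[OF gas] triangle_gas.rho_le_1[OF gas] in auto)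
next
  case (Suc k)
  have gas: "triangle_gas n q" for n
    by unfold_locales (use q in \<open>auto intro: finite_imp_finite_nsets\<close>)
  have "0 \<le> a" using q a by simp
  then have "exp (- (a * y\<^sup>2)) \<le> 1" by simp
  then have y01: "0 \<le> y" "y \<le> 1" using y exp_ge_zero[of "- (a * y\<^sup>2)"] by linarith+
  obtain lo hi \<alpha> \<beta> where lim: "lo \<longlonglongrightarrow> \<alpha>" "hi \<longlonglongrightarrow> \<beta>"
    and ab: "\<alpha> \<in> {0..1}" "\<beta> \<in> {0..1}" "\<bar>\<alpha> - y\<bar> \<le> (2 * a) ^ k" "\<bar>\<beta> - y\<bar> \<le> (2 * a) ^ k"
    and range: "\<And>n. L n \<le> 1 \<Longrightarrow> lo n \<in> {0..1}" "\<And>n. L n \<le> 1 \<Longrightarrow> hi n \<in> {0..1}"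
    and rec: "\<And>n M H e. L n \<le> 1 \<Longrightarrow> triangle_gas.admissible n (m + 2) M H e \<Longrightarrow>
       lo n \<le> triangle_gas.rho n q (L n) M H e \<and> triangle_gas.rho n q (L n) M H e \<le> hi n"
    using Suc.IH[of "m + 2"] by metis
  \<comment> \<open>The recursion is order-reversing, so the new lower bound is built from the old
    upper bound and vice versa. The extra factors in \<open>lo'\<close> tend to 1.\<close>
  define lo' where "lo' n = (1 - (1 - q) * (L n)\<^sup>2 * (hi n)\<^sup>2) ^ n * (1 - (1 - q) * L n) ^ (2 * m) / (1 + L n)" for n
  define hi' where "hi' n = (1 - (1 - q) * (L n)\<^sup>2 * (lo n)\<^sup>2) ^ (n - 2 - 2 * m)" for n
  have LL: "L \<longlonglongrightarrow> 0" by (rule tendsto_zero_of_sqrt_scaled[OF L])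
  have sq: "(\<lambda>n. real (n - c) * ((1 - q) * (L n)\<^sup>2 * (f n)\<^sup>2)) \<longlonglongrightarrow> a * \<gamma>\<^sup>2"
    if "f \<longlonglongrightarrow> \<gamma>" for f \<gamma> c
  proof -
    have "(\<lambda>n. (1 - q) * (real (n - c) * (L n)\<^sup>2) * (f n)\<^sup>2) \<longlonglongrightarrow> (1 - q) * s\<^sup>2 * \<gamma>\<^sup>2"
      by (intro tendsto_intros tendsto_shifted_square L that)
    then show ?thesis unfolding a by (simp add: mult_ac)
  qed
  have small: "(\<lambda>n. (1 - q) * (L n)\<^sup>2 * (f n)\<^sup>2) \<longlonglongrightarrow> 0" if "f \<longlonglongrightarrow> \<gamma>" for f \<gamma>
  proof -
    have "(\<lambda>n. (1 - q) * (L n)\<^sup>2 * (f n)\<^sup>2) \<longlonglongrightarrow> (1 - q) * 0\<^sup>2 * \<gamma>\<^sup>2"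
      by (intro tendsto_intros LL that)
    then show ?thesis by simp
  qed
  have "lo' \<longlonglongrightarrow> exp (- (a * \<beta>\<^sup>2)) * (1 - (1 - q) * 0) ^ (2 * m) / (1 + 0)"
    unfolding lo'_def
  proof (intro tendsto_divide tendsto_mult tendsto_power tendsto_add tendsto_diff tendsto_const LL)
    show "(\<lambda>n. (1 - (1 - q) * (L n)\<^sup>2 * (hi n)\<^sup>2) ^ n) \<longlonglongrightarrow> exp (- (a * \<beta>\<^sup>2))"
      by (rule tendsto_power_exp[OF small[OF lim(2)]]) (use sq[OF lim(2), of 0] in simp)
  qed simp
  then have lo'_lim: "lo' \<longlonglongrightarrow> exp (- (a * \<beta>\<^sup>2))" by simp
  have hi'_lim: "hi' \<longlonglongrightarrow> exp (- (a * \<alpha>\<^sup>2))"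
    unfolding hi'_def using sq[OF lim(1), of "2 + 2 * m"]
    by (intro tendsto_power_exp small[OF lim(1)]) simp
  have contr: "\<bar>exp (- (a * \<gamma>\<^sup>2)) - y\<bar> \<le> (2 * a) ^ Suc k" if "\<gamma> \<in> {0..1}" "\<bar>\<gamma> - y\<bar> \<le> (2 * a) ^ k" for \<gamma>
  proof -
    have "\<bar>exp (- (a * \<gamma>\<^sup>2)) - y\<bar> = \<bar>exp (- (a * \<gamma>\<^sup>2)) - exp (- (a * y\<^sup>2))\<bar>" by (simp flip: y)
    also have "\<dots> \<le> 2 * a * \<bar>\<gamma> - y\<bar>"
      using that y01 \<open>0 \<le> a\<close> by (intro exp_neg_square_contraction) auto
    also have "\<dots> \<le> 2 * a * (2 * a) ^ k" using that \<open>0 \<le> a\<close> by (intro mult_left_mono) auto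
    finally show ?thesis by simp
  qed
  have main: "lo' n \<in> {0..1} \<and> hi' n \<in> {0..1} \<and> (\<forall>M H e. triangle_gas.admissible n m M H e \<longrightarrow>
          lo' n \<le> triangle_gas.rho n q (L n) M H e \<and> triangle_gas.rho n q (L n) M H e \<le> hi' n)"
    if Ln: "L n \<le> 1" for n
  proof -
    interpret triangle_gas n q by (rule gas)
    have unit: "0 \<le> 1 - (1 - q) * (L n)\<^sup>2 * x\<^sup>2" "1 - (1 - q) * (L n)\<^sup>2 * x\<^sup>2 \<le> 1" if "x \<in> {0..1}" for x
      using that q Ln L0[of n] by (auto intro!: mult_le_one mult_nonneg_nonneg power_le_one)
    have unit': "0 \<le> 1 - (1 - q) * L n" "1 - (1 - q) * L n \<le> 1"
      using q Ln L0[of n] by (auto intro!: mult_le_one)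
    have hi'1: "hi' n \<in> {0..1}"
      unfolding hi'_def using unit[OF range(1)[OF Ln]] by (auto intro: power_le_one)
    have p: "0 \<le> (1 - (1 - q) * (L n)\<^sup>2 * (hi n)\<^sup>2) ^ n * (1 - (1 - q) * L n) ^ (2 * m)"
      "(1 - (1 - q) * (L n)\<^sup>2 * (hi n)\<^sup>2) ^ n * (1 - (1 - q) * L n) ^ (2 * m) \<le> 1"
      using unit[OF range(2)[OF Ln]] unit' by (auto intro!: mult_le_one power_le_one)
    then have lo'1: "lo' n \<in> {0..1}"
      unfolding lo'_def using L0[of n] by (auto simp: divide_le_eq)
    have "lo' n \<le> rho (L n) M H e" "rho (L n) M H e \<le> hi' n" if "admissible m M H e" for M H e
      using rho_step[OF L0 Ln rec[OF Ln] _ _ that] range[OF Ln]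
      unfolding lo'_def hi'_def by auto
    with lo'1 hi'1 show ?thesis by blast
  qed
  have unit: "exp (- (a * \<gamma>\<^sup>2)) \<in> {0..1}" for \<gamma> using \<open>0 \<le> a\<close> by simp
  show ?case
    using lo'_lim hi'_lim unit contr[OF ab(1,3)] contr[OF ab(2,4)] main by blast
qed

text \<open>First fix k with (2 a)^k below \<epsilon> / 2, then let n grow. Only the limits of the
  k-th bounds enter, so no uniformity in k is required, and the bounds are the same for all
  edges.\<close>

lemma rho_tendsto:
  fixes L :: "nat \<Rightarrow> real"
  assumes q: "0 < q" "q \<le> 1"
    and L0: "\<And>n. 0 \<le> L n" and L: "(\<lambda>n. sqrt (real n) * L n) \<longlonglongrightarrow> s"
    and a: "a = (1 - q) * s\<^sup>2" "2 * a < 1"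
    and y: "y = exp (- (a * y\<^sup>2))"
    and e: "0 < \<epsilon>"
  shows "\<forall>\<^sub>F n in sequentially. \<forall>e\<in>nsets {..<n} 2.
      \<bar>triangle_gas.rho n q (L n) {} (triangles n) e - y\<bar> < \<epsilon>"
proof -
  have "0 \<le> 2 * a" using q a by simp
  then have "(\<lambda>k. (2 * a) ^ k) \<longlonglongrightarrow> 0" using a by (intro LIMSEQ_power_zero) simp
  then have "\<forall>\<^sub>F k in sequentially. (2 * a) ^ k < \<epsilon> / 2" by (rule order_tendstoD) (use e in simp)
  then obtain k where k: "(2 * a) ^ k < \<epsilon> / 2" unfolding eventually_sequentially by blast
  obtain lo hi \<alpha> \<beta> where lim: "lo \<longlonglongrightarrow> \<alpha>" "hi \<longlonglongrightarrow> \<beta>"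
    and ab: "\<bar>\<alpha> - y\<bar> \<le> (2 * a) ^ k" "\<bar>\<beta> - y\<bar> \<le> (2 * a) ^ k"
    and rec: "\<And>n M H e. L n \<le> 1 \<Longrightarrow> triangle_gas.admissible n 0 M H e \<Longrightarrow>
       lo n \<le> triangle_gas.rho n q (L n) M H e \<and> triangle_gas.rho n q (L n) M H e \<le> hi n"
    using rho_bounds[OF q L0 L a(1) y, of k 0] by metis
  have "\<forall>\<^sub>F n in sequentially. L n < 1"
    by (rule order_tendstoD(2)[OF tendsto_zero_of_sqrt_scaled[OF L]]) simp
  moreover have "\<forall>\<^sub>F n in sequentially. \<alpha> - \<epsilon> / 2 < lo n"
    by (rule order_tendstoD(1)[OF lim(1)]) (use e in simp)
  moreover have "\<forall>\<^sub>F n in sequentially. hi n < \<beta> + \<epsilon> / 2"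
    by (rule order_tendstoD(2)[OF lim(2)]) (use e in simp)
  ultimately show ?thesis
  proof eventually_elim
    case (elim n)
    interpret triangle_gas n q
      by unfold_locales (use q in \<open>auto intro: finite_imp_finite_nsets\<close>)
    show ?case
    proof
      fix e assume "e \<in> pairs"
      from rec[OF _ admissible_start[OF this]] elim
      have "lo n \<le> rho (L n) {} (triangles n) e" "rho (L n) {} (triangles n) e \<le> hi n" by auto
      then show "\<bar>rho (L n) {} (triangles n) e - y\<bar> < \<epsilon>" using elim k ab by linarith
    qed
  qed
qed

text \<open>The logarithmic derivative of the partition function in \<open>l\<close>, per pair of
  vertices. For n < 2 there are no pairs and the value is 0 / 0 = 0.\<close>

definition mean_rho :: "nat \<Rightarrow> real \<Rightarrow> real \<Rightarrow> real" where
  "mean_rho n q l = (\<Sum>e\<in>nsets {..<n} 2. triangle_gas.rho n q l {} (triangles n) e) / card (nsets {..<n} 2)"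

lemma mean_rho_tendsto:
  fixes L :: "nat \<Rightarrow> real"
  assumes q: "0 < q" "q \<le> 1"
    and L0: "\<And>n. 0 \<le> L n" and L: "(\<lambda>n. sqrt (real n) * L n) \<longlonglongrightarrow> s"
    and a: "a = (1 - q) * s\<^sup>2" "2 * a < 1"
    and y: "y = exp (- (a * y\<^sup>2))"
  shows "(\<lambda>n. mean_rho n q (L n)) \<longlonglongrightarrow> y"
proof (rule LIMSEQ_I)
  fix \<epsilon> :: real assume e: "0 < \<epsilon>"
  have "\<forall>\<^sub>F n in sequentially. norm (mean_rho n q (L n) - y) < \<epsilon>"
    using rho_tendsto[OF assms e] eventually_ge_at_top[of 2]
  proof eventually_elim
    case (elim n)
    let ?r = "triangle_gas.rho n q (L n) {} (triangles n)" and ?P = "nsets {..<n} 2"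
    have P: "finite ?P" by (simp add: finite_imp_finite_nsets)
    have "{0, 1} \<in> ?P" using elim by simp
    then have P': "?P \<noteq> {}" by blast
    have c: "0 < real (card ?P)" unfolding of_nat_0_less_iff card_gt_0_iff using P P' by blast
    have "\<bar>(\<Sum>e\<in>?P. ?r e) - card ?P * y\<bar> = \<bar>\<Sum>e\<in>?P. ?r e - y\<bar>" by (simp add: sum_subtractf)
    also have "\<dots> \<le> (\<Sum>e\<in>?P. \<bar>?r e - y\<bar>)" by (rule sum_abs)
    also have "\<dots> < (\<Sum>e\<in>?P. \<epsilon>)" using elim(1) P P' by (intro sum_strict_mono) blast+
    finally have "\<bar>(\<Sum>e\<in>?P. ?r e) - card ?P * y\<bar> < card ?P * \<epsilon>" by simp
    moreover have "mean_rho n q (L n) - y = ((\<Sum>e\<in>?P. ?r e) - card ?P * y) / card ?P"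
      unfolding mean_rho_def using c by (simp add: diff_divide_distrib)
    ultimately show ?case using c by (simp add: divide_less_eq mult.commute)
  qed
  then show "\<exists>no. \<forall>n\<ge>no. norm (mean_rho n q (L n) - y) < \<epsilon>" by (simp add: eventually_sequentially)
qed

section \<open>Asymptotics of the partition function\<close>

text \<open>The initial value for integrating ln Z in \<open>l\<close>. An empty hyperedge would
  cost a factor \<open>q\<close> even in the empty configuration.\<close>

lemma (in hypergraph_gas) Z_zero:
  assumes "{} \<notin> H"
  shows "Z 0 {} H = 1"
proof -
  have "Z 0 {} H = (\<Sum>G\<in>Pow P. if G = {} then 1 else 0)"
    unfolding Z_def
  proof (rule sum.cong)
    fix G assume "G \<in> Pow P"
    then have "finite G" using finite_sites finite_subset by blast
    moreover have e: "{T \<in> H. T \<subseteq> {} \<union> {}} = {}" using assms by auto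
    ultimately show "0 ^ card G * q ^ card {T \<in> H. T \<subseteq> G \<union> {}} = (if G = {} then 1 else 0)"
    proof (cases "G = {}")
      case True
      show ?thesis unfolding True e by simp
    qed (simp add: power_0_left)
  qed simp
  then show ?thesis using finite_sites by (simp add: sum.delta)
qed

lemma (in hypergraph_gas) continuous_on_Z [continuous_intros]:
  "continuous_on S f \<Longrightarrow> continuous_on S (\<lambda>x. Z (f x) M H)"
  unfolding Z_def by (intro continuous_intros)

text \<open>Supplies the uniform bound for dominated convergence in the integration over
  \<open>l\<close>.\<close>

lemma mean_rho_bounds:
  assumes q: "0 < q" "q \<le> 1" and l: "0 \<le> l"
  shows "0 \<le> mean_rho n q l" "mean_rho n q l \<le> 1"
proof -
  interpret triangle_gas n q
    by unfold_locales (use q in \<open>auto intro: finite_imp_finite_nsets\<close>)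
  have "rho l {} (triangles n) e \<le> 1" if "e \<in> pairs" for e
    using rho_le_1[OF l admissible_start[OF that]] .
  then have "(\<Sum>e\<in>pairs. rho l {} (triangles n) e) \<le> (\<Sum>e\<in>pairs. 1)" by (rule sum_mono)
  then show "mean_rho n q l \<le> 1" unfolding mean_rho_def
    by (cases "card pairs = 0") (simp_all add: divide_le_eq del: card_eq_0_iff)
  show "0 \<le> mean_rho n q l" unfolding mean_rho_def
    by (intro divide_nonneg_nonneg sum_nonneg rho_nonneg l) simp
qed

text \<open>About n^2 / 2 pairs with weight of order c / sqrt n each: this is where the
  normalisation n^(3/2) arises.\<close>

lemma tendsto_pairs_scaled:
  fixes L :: "nat \<Rightarrow> real"
  assumes L: "(\<lambda>n. sqrt (real n) * L n) \<longlonglongrightarrow> c"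
  shows "(\<lambda>n. real (n choose 2) * L n / real n powr (3/2)) \<longlonglongrightarrow> c / 2"
proof -
  have "(\<lambda>n. sqrt (real n) * L n * (1 - inverse (real n)) / 2) \<longlonglongrightarrow> c * (1 - 0) / 2"
    by (intro tendsto_intros L tendsto_inverse_0_at_top filterlim_real_sequentially) simp
  moreover have "\<forall>\<^sub>F n in sequentially.
      sqrt (real n) * L n * (1 - inverse (real n)) / 2 = real (n choose 2) * L n / real n powr (3/2)"
    using eventually_ge_at_top[of 2]
  proof eventually_elim
    case (elim n)
    have "2 dvd n * (n - 1)" by (cases n) simp_all
    then have "real (n choose 2) = real (n * (n - 1)) / 2"
      unfolding choose_two by (simp add: real_of_nat_div)
    also have "\<dots> = real n * (real n - 1) / 2" using elim by (simp add: of_nat_diff)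
    finally have ch: "real (n choose 2) = real n * (real n - 1) / 2" .
    have "real n powr (3/2) = real n powr (1 + 1/2)" by simp
    also have "\<dots> = real n * sqrt (real n)" using elim by (subst powr_add) (simp add: powr_half_sqrt)
    finally have pw: "real n powr (3/2) = real n * sqrt (real n)" .
    have sq: "sqrt (real n) * sqrt (real n) = real n" by simp
    have pos: "0 < real n" "0 < sqrt (real n)" using elim by auto
    have "sqrt (real n) * L n * (1 - inverse (real n)) / 2 * (real n * sqrt (real n))
        = (sqrt (real n) * sqrt (real n)) * (real n * (1 - inverse (real n)) / 2) * L n" by simp
    also have "\<dots> = real n * ((real n - 1) / 2) * L n"
      using pos by (simp add: right_diff_distrib)
    finally show ?case unfolding ch pw using pos by (simp add: eq_divide_eq)
  qed
  ultimately show ?thesis by (auto intro: Lim_transform_eventually)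
qed

text \<open>
  Along the path \<open>l = L n * (w * exp (a w\<^sup>2))\<close> the fixed point of the limiting recursion is
  \<open>exp (- a w\<^sup>2)\<close>, so that the limit of the logarithmic derivative is the polynomial
  \<open>1 + 2 a w\<^sup>2\<close>.
\<close>

lemma ln_partition_function_tendsto:
  fixes L :: "nat \<Rightarrow> real"
  assumes q: "0 < q" "q \<le> 1"
    and L0: "\<And>n. 0 \<le> L n" and L: "(\<lambda>n. sqrt (real n) * L n) \<longlonglongrightarrow> c"
    and a: "a = (1 - q) * c\<^sup>2" "2 * a < 1"
    and y: "y = exp (- (a * y\<^sup>2))"
  shows "(\<lambda>n. ln (hypergraph_gas.Z (nsets {..<n} 2) q (L n) {} (triangles n)) / real n powr (3/2))
      \<longlonglongrightarrow> c / 2 * (y + 2 / 3 * a * y ^ 3)"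
proof -
  have gas: "triangle_gas n q" for n
    by unfold_locales (use q in \<open>auto intro: finite_imp_finite_nsets\<close>)
  have a0: "0 \<le> a" using q a by simp
  have y0: "0 \<le> y" using y exp_ge_zero[of "- (a * y\<^sup>2)"] by linarith
  define \<tau> where "\<tau> w = w * exp (a * w\<^sup>2)" for w :: real
  define \<tau>' where "\<tau>' w = (1 + 2 * a * w\<^sup>2) * exp (a * w\<^sup>2)" for w :: real
  define G where "G n w = mean_rho n q (L n * \<tau> w) * \<tau>' w" for n w
  have \<tau>_deriv: "(\<tau> has_real_derivative \<tau>' w) (at w)" for w
    unfolding \<tau>_def \<tau>'_def by (auto intro!: derivative_eq_intros simp: algebra_simps power2_eq_square)
  \<comment> \<open>The fixed point equation for \<open>y\<close> makes the path
    \<open>L n * \<tau> w\<close> run from 0 at w = 0 to exactly \<open>L n\<close> at w =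
    y.\<close>
  have \<tau>_y: "\<tau> y = 1"
  proof -
    have "\<tau> y = exp (- (a * y\<^sup>2)) * exp (a * y\<^sup>2)" unfolding \<tau>_def using y by simp
    then show ?thesis by (simp flip: exp_add)
  qed
  have \<tau>_range: "0 \<le> \<tau> w" "\<tau> w \<le> 1" if "w \<in> {0..y}" for w
  proof -
    show "0 \<le> \<tau> w" using that unfolding \<tau>_def by simp
    have "\<tau> w \<le> \<tau> y" unfolding \<tau>_def using that a0
      by (intro mult_mono) (auto intro!: mult_left_mono power_mono)
    then show "\<tau> w \<le> 1" by (simp add: \<tau>_y)
  qed
  have \<tau>'_pos: "0 \<le> \<tau>' w" for w unfolding \<tau>'_def using a0 by simp
  have G_cont: "continuous_on {0..y} (G n)" for n
  proof -
    interpret triangle_gas n q by (rule gas)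
    have \<tau>_cont: "continuous_on {0..y} \<tau>" "continuous_on {0..y} \<tau>'"
      unfolding \<tau>_def \<tau>'_def by (intro continuous_intros)+
    have nz: "Z (L n * \<tau> w) {} (triangles n) \<noteq> 0" if "w \<in> {0..y}" for w
      using Z_pos[of "L n * \<tau> w" "{}" "triangles n"] L0[of n] \<tau>_range(1)[OF that] by simp
    show ?thesis
      unfolding G_def mean_rho_def rho_def divide_inverse
      by (intro continuous_on_mult continuous_on_sum continuous_on_inverse continuous_on_const
          continuous_on_Z \<tau>_cont ballI nz)
  qed
  have G_lim: "(\<lambda>n. G n w) \<longlonglongrightarrow> 1 + 2 * a * w\<^sup>2" if w: "w \<in> {0..y}" for w
  proof -
    have "(\<lambda>n. mean_rho n q (L n * \<tau> w)) \<longlonglongrightarrow> exp (- (a * w\<^sup>2))"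
    proof (rule mean_rho_tendsto[OF q])
      show "0 \<le> L n * \<tau> w" for n using L0 \<tau>_range(1)[OF w] by simp
      show "(\<lambda>n. sqrt (real n) * (L n * \<tau> w)) \<longlonglongrightarrow> c * \<tau> w"
        using tendsto_mult_right[OF L, of "\<tau> w"] by (simp add: mult.assoc)
      show "a * (\<tau> w)\<^sup>2 = (1 - q) * (c * \<tau> w)\<^sup>2" unfolding a by (simp add: power_mult_distrib)
      \<comment> \<open>Scaling the activity by \<open>\<tau> w\<close> replaces \<open>a\<close> by
        \<open>a * (\<tau> w)\<^sup>2\<close>, which is no larger since \<open>\<tau> w\<close> is
        at most 1. So the contraction condition holds along the whole path.\<close>
      have "a * (\<tau> w)\<^sup>2 \<le> a * 1" using a0 \<tau>_range[OF w] by (intro mult_left_mono power_le_one) auto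
      then show "2 * (a * (\<tau> w)\<^sup>2) < 1" using a(2) by simp
      have "\<tau> w * exp (- (a * w\<^sup>2)) = w" unfolding \<tau>_def by (simp add: mult.assoc flip: exp_add)
      then have "a * (\<tau> w)\<^sup>2 * (exp (- (a * w\<^sup>2)))\<^sup>2 = a * w\<^sup>2"
        by (simp add: mult.assoc flip: power_mult_distrib)
      then show "exp (- (a * w\<^sup>2)) = exp (- (a * (\<tau> w)\<^sup>2 * (exp (- (a * w\<^sup>2)))\<^sup>2))" by (simp only:)
    qed
    then have "(\<lambda>n. G n w) \<longlonglongrightarrow> exp (- (a * w\<^sup>2)) * \<tau>' w"
      unfolding G_def by (rule tendsto_mult_right)
    moreover have "exp (- (a * w\<^sup>2)) * \<tau>' w = 1 + 2 * a * w\<^sup>2"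
      unfolding \<tau>'_def by (simp add: algebra_simps flip: exp_add)
    ultimately show ?thesis by simp
  qed
  have "(\<lambda>n. integral {0..y} (G n)) \<longlonglongrightarrow> integral {0..y} (\<lambda>w. 1 + 2 * a * w\<^sup>2)"
  proof (rule dominated_convergence)
    show "G n integrable_on {0..y}" for n by (rule integrable_continuous_interval[OF G_cont])
    show "\<tau>' integrable_on {0..y}"
      unfolding \<tau>'_def by (intro integrable_continuous_interval continuous_intros)
    fix n w assume w: "w \<in> {0..y}"
    have "0 \<le> L n * \<tau> w" using L0 \<tau>_range(1)[OF w] by simp
    from mean_rho_bounds[OF q this, of n] have "\<bar>mean_rho n q (L n * \<tau> w)\<bar> * \<tau>' w \<le> 1 * \<tau>' w"
      using \<tau>'_pos by (intro mult_right_mono) auto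
    then show "norm (G n w) \<le> \<tau>' w" unfolding G_def using \<tau>'_pos by (simp add: abs_mult)
  qed (rule G_lim)
  also have "integral {0..y} (\<lambda>w. 1 + 2 * a * w\<^sup>2) = y + 2 / 3 * a * y ^ 3"
  proof (rule integral_unique)
    have "((\<lambda>w. 1 + 2 * a * w\<^sup>2) has_integral (y + 2 / 3 * a * y ^ 3) - (0 + 2 / 3 * a * 0 ^ 3)) {0..y}"
      using y0 by (intro fundamental_theorem_of_calculus)
        (auto intro!: derivative_eq_intros simp flip: has_real_derivative_iff_has_vector_derivative)
    then show "((\<lambda>w. 1 + 2 * a * w\<^sup>2) has_integral y + 2 / 3 * a * y ^ 3) {0..y}" by simp
  qed
  finally have int_lim: "(\<lambda>n. integral {0..y} (G n)) \<longlonglongrightarrow> y + 2 / 3 * a * y ^ 3" .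
  \<comment> \<open>An exact identity for every n: Z is 1 at activity 0, so ln Z is the integral of
    its logarithmic derivative along the path.\<close>
  have lnZ: "ln (hypergraph_gas.Z (nsets {..<n} 2) q (L n) {} (triangles n))
      = real (n choose 2) * L n * integral {0..y} (G n)" for n
  proof -
    interpret triangle_gas n q by (rule gas)
    let ?Z = "\<lambda>l. Z l {} (triangles n)"
    define F where "F w = ln (?Z (L n * \<tau> w))" for w
    have "((\<lambda>w. real (n choose 2) * L n * G n w) has_integral F y - F 0) {0..y}"
    proof (rule fundamental_theorem_of_calculus[OF y0])
      fix w assume w: "w \<in> {0..y}"
      have pos: "0 < ?Z (L n * \<tau> w)" using Z_pos L0 \<tau>_range(1)[OF w] by simp
      have "(F has_real_derivative (\<Sum>e\<in>pairs. Z (L n * \<tau> w) {e} (triangles n)) * (L n * \<tau>' w) / ?Z (L n * \<tau> w)) (at w)"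
        unfolding F_def using pos
        by (auto intro!: derivative_eq_intros DERIV_chain2[OF has_derivative_Z] \<tau>_deriv)
      also have "(\<Sum>e\<in>pairs. Z (L n * \<tau> w) {e} (triangles n)) * (L n * \<tau>' w) / ?Z (L n * \<tau> w)
          = real (n choose 2) * L n * G n w"
      proof (cases "card pairs = 0")
        case True
        moreover have "finite pairs" by (rule finite_sites)
        ultimately have "pairs = {}" unfolding card_eq_0_iff by blast
        then show ?thesis unfolding G_def mean_rho_def by (simp flip: card_nsets_lessThan)
      next
        case False
        have cancel: "x = N * (x / N)" if "N \<noteq> 0" for x N :: real using that by simp
        have "(\<Sum>e\<in>pairs. Z (L n * \<tau> w) {e} (triangles n)) / ?Z (L n * \<tau> w)
            = (\<Sum>e\<in>pairs. rho (L n * \<tau> w) {} (triangles n) e)"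
          unfolding rho_def by (rule sum_divide_distrib)
        also have "\<dots> = real (card pairs) * mean_rho n q (L n * \<tau> w)"
          unfolding mean_rho_def by (rule cancel) (use False in \<open>simp only: of_nat_eq_0_iff not_False_eq_True\<close>)
        finally have "(\<Sum>e\<in>pairs. Z (L n * \<tau> w) {e} (triangles n)) / ?Z (L n * \<tau> w) * (L n * \<tau>' w)
            = real (n choose 2) * L n * G n w"
          unfolding G_def card_nsets_lessThan by simp
        then show ?thesis unfolding times_divide_eq_left .
      qed
      finally show "(F has_vector_derivative real (n choose 2) * L n * G n w) (at w within {0..y})"
        by (simp add: has_real_derivative_iff_has_vector_derivative has_vector_derivative_at_within)
    qed
    then have "integral {0..y} (\<lambda>w. real (n choose 2) * L n * G n w) = F y - F 0" by (rule integral_unique)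
    moreover have "{} \<notin> triangles n" unfolding triangles_eq by (auto simp: tri_def)
    then have "F 0 = 0" unfolding F_def \<tau>_def by (simp add: Z_zero)
    ultimately show ?thesis unfolding F_def by (simp add: \<tau>_y)
  qed
  have "(\<lambda>n. real (n choose 2) * L n / real n powr (3/2) * integral {0..y} (G n))
      \<longlonglongrightarrow> c / 2 * (y + 2 / 3 * a * y ^ 3)"
    by (intro tendsto_mult tendsto_pairs_scaled L int_lim)
  then show ?thesis unfolding lnZ by simp
qed

section \<open>Lower tails from exponential moments\<close>

lemma eventually_less_of_tendsto_neg_ratio:
  fixes f v :: "nat \<Rightarrow> real"
  assumes v: "filterlim v at_top sequentially" and f: "(\<lambda>n. f n / v n) \<longlonglongrightarrow> l" "l < 0"
  shows "\<forall>\<^sub>F n in sequentially. f n < C"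
proof -
  have "filterlim (\<lambda>n. f n / v n * v n) at_bot sequentially"
    by (rule filterlim_tendsto_neg_mult_at_bot[OF f v])
  then have "\<forall>\<^sub>F n in sequentially. f n / v n * v n < C"
    unfolding filterlim_at_bot_dense by blast
  moreover have "\<forall>\<^sub>F n in sequentially. 0 < v n"
    using v unfolding filterlim_at_top_dense by blast
  ultimately show ?thesis by eventually_elim simp
qed

lemma measure_pmf_integrable_exp_neg:
  fixes X :: "'a \<Rightarrow> real"
  assumes "\<And>x. 0 \<le> X x" "0 \<le> \<alpha>"
  shows "integrable (measure_pmf p) (\<lambda>x. exp (- (\<alpha> * X x)))"
  by (rule measure_pmf.integrable_const_bound[where B = 1]) (use assms in auto)

lemma measure_pmf_expectation_exp_pos:
  fixes X :: "'a \<Rightarrow> real"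
  assumes "\<And>x. 0 \<le> X x" "0 \<le> \<alpha>"
  shows "0 < measure_pmf.expectation p (\<lambda>x. exp (- (\<alpha> * X x)))"
proof -
  obtain a where a: "a \<in> set_pmf p" using set_pmf_not_empty[of p] by blast
  have "0 < exp (- (\<alpha> * X a)) * pmf p a" using a by (simp add: pmf_positive)
  also have "\<dots> = (\<Sum>x\<in>{a}. exp (- (\<alpha> * X x)) * pmf p x)" by simp
  also have "\<dots> = measure_pmf.expectation p (\<lambda>x. exp (- (\<alpha> * X x)) * indicator {a} x)"
    by (subst integral_measure_pmf_real[where A = "{a}"]) (auto split: split_indicator_asm)
  also have "\<dots> \<le> measure_pmf.expectation p (\<lambda>x. exp (- (\<alpha> * X x)))"
  proof (rule integral_mono)
    show "integrable (measure_pmf p) (\<lambda>x. exp (- (\<alpha> * X x)) * indicator {a} x)"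
      by (rule measure_pmf.integrable_const_bound[where B = 1])
        (use assms in \<open>auto split: split_indicator\<close>)
  qed (use measure_pmf_integrable_exp_neg[of X, OF assms] in \<open>auto split: split_indicator\<close>)
  finally show ?thesis .
qed

text \<open>The Chernoff bound for the lower tail.\<close>

lemma prob_le_exp_moment:
  fixes X :: "'a \<Rightarrow> real"
  assumes "\<And>x. 0 \<le> X x" "0 \<le> \<alpha>"
  shows "measure_pmf.prob p {x. X x \<le> t} \<le> exp (\<alpha> * t) * measure_pmf.expectation p (\<lambda>x. exp (- (\<alpha> * X x)))"
proof -
  have "measure_pmf.prob p {x. X x \<le> t} = measure_pmf.expectation p (indicator {x. X x \<le> t})" by simp
  also have "\<dots> \<le> measure_pmf.expectation p (\<lambda>x. exp (\<alpha> * t) * exp (- (\<alpha> * X x)))"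
  proof (rule integral_mono)
    fix x
    have "1 \<le> exp (\<alpha> * t) * exp (- (\<alpha> * X x))" if "X x \<le> t"
    proof -
      have "0 \<le> \<alpha> * t + - (\<alpha> * X x)" using that assms(2) by (simp add: mult_left_mono)
      then show ?thesis by (simp flip: exp_add)
    qed
    then show "indicator {x. X x \<le> t} x \<le> exp (\<alpha> * t) * exp (- (\<alpha> * X x))"
      by (simp split: split_indicator)
  qed (use measure_pmf_integrable_exp_neg[of X, OF assms] in
      \<open>auto intro!: measure_pmf.integrable_const_bound[where B = 1] split: split_indicator\<close>)
  finally show ?thesis by simp
qed

text \<open>The three summands dominate the contributions of \<open>X \<le> s\<close>, \<open>s < X \<le> t\<close> and \<open>t < X\<close>.\<close>

lemma exp_moment_split:
  fixes X :: "'a \<Rightarrow> real"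
  defines "Z \<equiv> \<lambda>p \<alpha>. measure_pmf.expectation p (\<lambda>x. exp (- (\<alpha> * X x)))"
  assumes X: "\<And>x. 0 \<le> X x" and \<theta>: "0 \<le> \<theta>" "\<theta> \<le> \<alpha>" "\<alpha> \<le> \<beta>"
  shows "Z p \<alpha> \<le> exp ((\<beta> - \<alpha>) * s) * Z p \<beta> + exp (- (\<alpha> * s)) * measure_pmf.prob p {x. X x \<le> t}
      + exp (- ((\<alpha> - \<theta>) * t)) * Z p \<theta>"
proof -
  note int = measure_pmf_integrable_exp_neg[of X, OF X]
  have ind: "integrable (measure_pmf p) (indicator {x. X x \<le> t} :: 'a \<Rightarrow> real)"
    by (rule measure_pmf.integrable_const_bound[where B = 1]) (auto split: split_indicator)
  have "Z p \<alpha> \<le> measure_pmf.expectation p (\<lambda>x. exp ((\<beta> - \<alpha>) * s) * exp (- (\<beta> * X x))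
      + exp (- (\<alpha> * s)) * indicator {x. X x \<le> t} x + exp (- ((\<alpha> - \<theta>) * t)) * exp (- (\<theta> * X x)))"
    unfolding Z_def
  proof (rule integral_mono)
    fix x
    consider "X x \<le> s" | "s < X x" "X x \<le> t" | "t < X x" by linarith
    then show "exp (- (\<alpha> * X x)) \<le> exp ((\<beta> - \<alpha>) * s) * exp (- (\<beta> * X x))
      + exp (- (\<alpha> * s)) * indicator {x. X x \<le> t} x + exp (- ((\<alpha> - \<theta>) * t)) * exp (- (\<theta> * X x))"
    proof cases
      case 1
      then have "(\<beta> - \<alpha>) * X x \<le> (\<beta> - \<alpha>) * s" using \<theta> by (intro mult_left_mono) auto
      then have "exp (- (\<alpha> * X x)) \<le> exp ((\<beta> - \<alpha>) * s) * exp (- (\<beta> * X x))"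
        by (simp add: algebra_simps flip: exp_add)
      moreover have "0 \<le> exp (- (\<alpha> * s)) * indicator {x. X x \<le> t} x"
        "0 \<le> exp (- ((\<alpha> - \<theta>) * t)) * exp (- (\<theta> * X x))" by simp_all
      ultimately show ?thesis by linarith
    next
      case 2
      then have "\<alpha> * s \<le> \<alpha> * X x" using \<theta> by (intro mult_left_mono) auto
      then have "exp (- (\<alpha> * X x)) \<le> exp (- (\<alpha> * s)) * indicator {x. X x \<le> t} x"
        using 2 by simp
      moreover have "0 \<le> exp ((\<beta> - \<alpha>) * s) * exp (- (\<beta> * X x))"
        "0 \<le> exp (- ((\<alpha> - \<theta>) * t)) * exp (- (\<theta> * X x))" by simp_all
      ultimately show ?thesis by linarith
    next
      case 3
      then have "(\<alpha> - \<theta>) * t \<le> (\<alpha> - \<theta>) * X x" using \<theta> by (intro mult_left_mono) auto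
      then have "exp (- (\<alpha> * X x)) \<le> exp (- ((\<alpha> - \<theta>) * t)) * exp (- (\<theta> * X x))"
        by (simp add: algebra_simps flip: exp_add)
      moreover have "0 \<le> exp (- (\<alpha> * s)) * indicator {x. X x \<le> t} x"
        "0 \<le> exp ((\<beta> - \<alpha>) * s) * exp (- (\<beta> * X x))" by simp_all
      ultimately show ?thesis by linarith
    qed
    show "integrable (measure_pmf p) (\<lambda>x. exp (- (\<alpha> * X x)))" using \<theta> by (intro int) auto
    show "integrable (measure_pmf p) (\<lambda>x. exp ((\<beta> - \<alpha>) * s) * exp (- (\<beta> * X x))
      + exp (- (\<alpha> * s)) * indicator {x. X x \<le> t} x + exp (- ((\<alpha> - \<theta>) * t)) * exp (- (\<theta> * X x)))"
      using \<theta> by (intro Bochner_Integration.integrable_add integrable_mult_right int ind) auto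
  qed
  also have "\<dots> = exp ((\<beta> - \<alpha>) * s) * Z p \<beta> + exp (- (\<alpha> * s)) * measure_pmf.prob p {x. X x \<le> t}
      + exp (- ((\<alpha> - \<theta>) * t)) * Z p \<theta>"
    unfolding Z_def using int[of \<beta> p] int[of \<theta> p] ind \<theta> by simp
  finally show ?thesis .
qed

text \<open>The Chernoff bound at \<open>\<theta>\<close> is the upper bound. For the lower bound,
  tilt by \<open>\<alpha>\<close> slightly above \<open>\<theta>\<close>: the two inequalities in
  \<open>slopes\<close> make the parts X > t and X <= s negligible in the moment at
  \<open>\<alpha>\<close>, so the window between s and t carries at least half of it. Secants to the
  right of \<open>\<theta>\<close> thus replace differentiability of \<open>A\<close>.\<close>

lemma lower_tail_exponent_tendsto:
  fixes p :: "nat \<Rightarrow> 'a pmf" and X :: "nat \<Rightarrow> 'a \<Rightarrow> real" and v t :: "nat \<Rightarrow> real" and A :: "real \<Rightarrow> real"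
  assumes X: "\<And>n x. 0 \<le> X n x"
    and v: "filterlim v at_top sequentially"
    and t: "(\<lambda>n. t n / v n) \<longlonglongrightarrow> \<tau>"
    and A: "\<And>\<alpha>. \<alpha> \<in> S \<Longrightarrow>
      (\<lambda>n. ln (measure_pmf.expectation (p n) (\<lambda>x. exp (- (\<alpha> * X n x)))) / v n) \<longlonglongrightarrow> A \<alpha>"
    and \<theta>: "0 \<le> \<theta>" "\<theta> \<in> S"
    and slopes: "\<And>\<epsilon>. 0 < \<epsilon> \<Longrightarrow> \<exists>\<alpha>\<in>S. \<exists>\<beta>\<in>S. \<theta> < \<alpha> \<and> \<alpha> < \<theta> + \<epsilon> \<and> \<alpha> < \<beta> \<and>
      A \<theta> - A \<alpha> < \<tau> * (\<alpha> - \<theta>) \<and> (\<tau> - \<epsilon>) * (\<beta> - \<alpha>) < A \<alpha> - A \<beta>"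
  shows "(\<lambda>n. ln (measure_pmf.prob (p n) {x. X n x \<le> t n}) / v n) \<longlonglongrightarrow> A \<theta> + \<theta> * \<tau>"
proof (rule LIMSEQ_I)
  fix \<delta> :: real assume \<delta>: "0 < \<delta>"
  define Z where "Z n \<alpha> = measure_pmf.expectation (p n) (\<lambda>x. exp (- (\<alpha> * X n x)))" for n \<alpha>
  define Q where "Q n = measure_pmf.prob (p n) {x. X n x \<le> t n}" for n
  have Zpos: "0 < Z n \<alpha>" if "0 \<le> \<alpha>" for n \<alpha>
    unfolding Z_def by (rule measure_pmf_expectation_exp_pos[OF X that])
  have A': "(\<lambda>n. ln (Z n \<alpha>) / v n) \<longlonglongrightarrow> A \<alpha>" if "\<alpha> \<in> S" for \<alpha>
    using A[OF that] unfolding Z_def .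
  have vpos: "\<forall>\<^sub>F n in sequentially. 0 < v n"
    using v unfolding filterlim_at_top_dense by blast
  \<comment> \<open>A window of width \<open>\<epsilon> * v n\<close> costs \<alpha> \<epsilon> in
    the exponent. The cap 1 gives \<alpha> < \<theta> + 1, so \<epsilon> (\<theta> + 2) <= \<delta>
    keeps this loss below \<delta>.\<close>
  define \<epsilon> where "\<epsilon> = min 1 (\<delta> / (\<theta> + 2))"
  have "\<epsilon> \<le> \<delta> / (\<theta> + 2)" unfolding \<epsilon>_def by simp
  then have "\<epsilon> * (\<theta> + 2) \<le> \<delta>" using \<theta> by (simp add: pos_le_divide_eq)
  moreover have "0 < \<epsilon>" "\<epsilon> \<le> 1" using \<delta> \<theta> by (simp_all add: \<epsilon>_def)
  ultimately have \<epsilon>: "0 < \<epsilon>" "\<epsilon> \<le> 1" "\<epsilon> * (\<theta> + 2) \<le> \<delta>" by simp_all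
  obtain \<alpha> \<beta> where ab: "\<alpha> \<in> S" "\<beta> \<in> S" "\<theta> < \<alpha>" "\<alpha> < \<theta> + \<epsilon>" "\<alpha> < \<beta>"
    and s1: "A \<theta> - A \<alpha> < \<tau> * (\<alpha> - \<theta>)" and s2: "(\<tau> - \<epsilon>) * (\<beta> - \<alpha>) < A \<alpha> - A \<beta>"
    using slopes[OF \<epsilon>(1)] by blast
  have a0: "0 \<le> \<alpha>" "0 \<le> \<beta>" using ab \<theta> by auto
  define s where "s n = (\<tau> - \<epsilon>) * v n" for n
  \<comment> \<open>\<open>neg1\<close> and \<open>neg2\<close> say that the contributions of X <= s
    and of X > t are each eventually below a quarter of the moment at
    \<open>\<alpha>\<close>.\<close>
  have neg1: "\<forall>\<^sub>F n in sequentially. (\<beta> - \<alpha>) * s n + ln (Z n \<beta>) - ln (Z n \<alpha>) < - ln 4"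
  proof (rule eventually_less_of_tendsto_neg_ratio[OF v])
    have "(\<lambda>n. (\<beta> - \<alpha>) * (\<tau> - \<epsilon>) + ln (Z n \<beta>) / v n - ln (Z n \<alpha>) / v n)
        \<longlonglongrightarrow> (\<beta> - \<alpha>) * (\<tau> - \<epsilon>) + A \<beta> - A \<alpha>"
      by (intro tendsto_intros A' ab)
    moreover have "\<forall>\<^sub>F n in sequentially. (\<beta> - \<alpha>) * (\<tau> - \<epsilon>) + ln (Z n \<beta>) / v n - ln (Z n \<alpha>) / v n
        = ((\<beta> - \<alpha>) * s n + ln (Z n \<beta>) - ln (Z n \<alpha>)) / v n"
      using vpos by eventually_elim (simp add: s_def add_divide_distrib diff_divide_distrib)
    ultimately show "(\<lambda>n. ((\<beta> - \<alpha>) * s n + ln (Z n \<beta>) - ln (Z n \<alpha>)) / v n)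
        \<longlonglongrightarrow> (\<beta> - \<alpha>) * (\<tau> - \<epsilon>) + A \<beta> - A \<alpha>"
      by (rule Lim_transform_eventually)
    show "(\<beta> - \<alpha>) * (\<tau> - \<epsilon>) + A \<beta> - A \<alpha> < 0" using s2 by (simp add: mult.commute)
  qed
  have neg2: "\<forall>\<^sub>F n in sequentially. - ((\<alpha> - \<theta>) * t n) + ln (Z n \<theta>) - ln (Z n \<alpha>) < - ln 4"
  proof (rule eventually_less_of_tendsto_neg_ratio[OF v])
    have "(\<lambda>n. - ((\<alpha> - \<theta>) * (t n / v n)) + ln (Z n \<theta>) / v n - ln (Z n \<alpha>) / v n)
        \<longlonglongrightarrow> - ((\<alpha> - \<theta>) * \<tau>) + A \<theta> - A \<alpha>"
      by (intro tendsto_intros A' ab \<theta> t)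
    then show "(\<lambda>n. (- ((\<alpha> - \<theta>) * t n) + ln (Z n \<theta>) - ln (Z n \<alpha>)) / v n)
        \<longlonglongrightarrow> - ((\<alpha> - \<theta>) * \<tau>) + A \<theta> - A \<alpha>"
      by (simp add: add_divide_distrib diff_divide_distrib)
    show "- ((\<alpha> - \<theta>) * \<tau>) + A \<theta> - A \<alpha> < 0" using s1 by (simp add: mult.commute)
  qed
  have quarter: "exp a * x \<le> y / 4" if "a + ln x - ln y < - ln 4" "0 < x" "0 < y" for a x y :: real
  proof -
    have "exp (a + ln x) < exp (ln y - ln 4)" using that(1) by (subst exp_less_cancel_iff) linarith
    moreover have "exp (a + ln x) = exp a * x" using that by (simp add: exp_add)
    moreover have "exp (ln y - ln 4) = y / 4" using that by (simp add: exp_diff)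
    ultimately show ?thesis by linarith
  qed
  have lower: "\<forall>\<^sub>F n in sequentially. ln (Z n \<alpha>) - ln 2 + \<alpha> * s n \<le> ln (Q n) \<and> 0 < Q n"
    using neg1 neg2
  proof eventually_elim
    case (elim n)
    have "Z n \<alpha> \<le> exp ((\<beta> - \<alpha>) * s n) * Z n \<beta> + exp (- (\<alpha> * s n)) * Q n + exp (- ((\<alpha> - \<theta>) * t n)) * Z n \<theta>"
      unfolding Z_def Q_def by (rule exp_moment_split) (use X ab \<theta> in auto)
    moreover have "exp ((\<beta> - \<alpha>) * s n) * Z n \<beta> \<le> Z n \<alpha> / 4"
      by (rule quarter[OF elim(1) Zpos[OF a0(2)] Zpos[OF a0(1)]])
    moreover have "exp (- ((\<alpha> - \<theta>) * t n)) * Z n \<theta> \<le> Z n \<alpha> / 4"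
      by (rule quarter[OF elim(2) Zpos[OF \<theta>(1)] Zpos[OF a0(1)]])
    ultimately have "Z n \<alpha> / 2 \<le> exp (- (\<alpha> * s n)) * Q n" by linarith
    then have "exp (\<alpha> * s n) * (Z n \<alpha> / 2) \<le> exp (\<alpha> * s n) * (exp (- (\<alpha> * s n)) * Q n)"
      by (intro mult_left_mono) auto
    also have "\<dots> = Q n" by (simp add: exp_minus field_simps)
    finally have le: "exp (\<alpha> * s n) * (Z n \<alpha> / 2) \<le> Q n" .
    have pos: "0 < exp (\<alpha> * s n) * (Z n \<alpha> / 2)" using Zpos[OF a0(1)] by simp
    have "ln (exp (\<alpha> * s n) * (Z n \<alpha> / 2)) = \<alpha> * s n + (ln (Z n \<alpha>) - ln 2)"
      using Zpos[OF a0(1), of n] by (simp add: ln_mult ln_div)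
    moreover have "ln (exp (\<alpha> * s n) * (Z n \<alpha> / 2)) \<le> ln (Q n)"
      using le pos by (intro ln_mono) auto
    ultimately show ?case using le pos by auto
  qed
  have lower_lim: "(\<lambda>n. ln (Z n \<alpha>) / v n - ln 2 / v n + \<alpha> * (\<tau> - \<epsilon>)) \<longlonglongrightarrow> A \<alpha> - 0 + \<alpha> * (\<tau> - \<epsilon>)"
    by (intro tendsto_intros A' ab tendsto_divide_0[OF tendsto_const] filterlim_at_top_imp_at_infinity v)
  \<comment> \<open>By \<open>s1\<close>, passing from \<open>\<theta>\<close> to
    \<open>\<alpha>\<close> increases A \<alpha> + \<alpha> \<tau>; only the window loss \<alpha>
    \<epsilon> has to be absorbed by \<delta>.\<close>
  have "A \<theta> + \<theta> * \<tau> - \<delta> < A \<alpha> - 0 + \<alpha> * (\<tau> - \<epsilon>)"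
  proof -
    have "\<alpha> * \<epsilon> \<le> (\<theta> + 1) * \<epsilon>" using ab \<epsilon> by (intro mult_right_mono) auto
    also have "\<dots> < \<epsilon> * (\<theta> + 2)" using \<epsilon> by (simp add: algebra_simps)
    finally have "\<alpha> * \<epsilon> < \<delta>" using \<epsilon>(3) by linarith
    then show ?thesis using s1 by (simp add: algebra_simps)
  qed
  from order_tendstoD(1)[OF lower_lim this]
  have ev_lower: "\<forall>\<^sub>F n in sequentially. A \<theta> + \<theta> * \<tau> - \<delta> < ln (Q n) / v n"
    using lower vpos
  proof eventually_elim
    case (elim n)
    have "ln (Z n \<alpha>) / v n - ln 2 / v n + \<alpha> * (\<tau> - \<epsilon>) = (ln (Z n \<alpha>) - ln 2 + \<alpha> * s n) / v n"
      using elim(3) by (simp add: s_def add_divide_distrib diff_divide_distrib)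
    also have "\<dots> \<le> ln (Q n) / v n" using elim by (intro divide_right_mono) auto
    finally show ?case using elim(1) by linarith
  qed
  have upper_lim: "(\<lambda>n. \<theta> * (t n / v n) + ln (Z n \<theta>) / v n) \<longlonglongrightarrow> \<theta> * \<tau> + A \<theta>"
    by (intro tendsto_intros A' \<theta> t)
  have "\<theta> * \<tau> + A \<theta> < A \<theta> + \<theta> * \<tau> + \<delta>" using \<delta> by simp
  from order_tendstoD(2)[OF upper_lim this]
  have ev_upper: "\<forall>\<^sub>F n in sequentially. ln (Q n) / v n < A \<theta> + \<theta> * \<tau> + \<delta>"
    using lower vpos
  proof eventually_elim
    case (elim n)
    have "Q n \<le> exp (\<theta> * t n) * Z n \<theta>"
      unfolding Q_def Z_def by (rule prob_le_exp_moment[OF X \<theta>(1)])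
    then have "ln (Q n) \<le> ln (exp (\<theta> * t n) * Z n \<theta>)" using elim by (intro ln_mono) auto
    also have "\<dots> = \<theta> * t n + ln (Z n \<theta>)" using Zpos[OF \<theta>(1), of n] by (simp add: ln_mult)
    finally have "ln (Q n) / v n \<le> (\<theta> * t n + ln (Z n \<theta>)) / v n"
      using elim by (intro divide_right_mono) auto
    then show ?case using elim(1) by (simp add: add_divide_distrib)
  qed
  have "\<forall>\<^sub>F n in sequentially. norm (ln (Q n) / v n - (A \<theta> + \<theta> * \<tau>)) < \<delta>"
    using ev_lower ev_upper by eventually_elim (simp add: abs_less_iff)
  then show "\<exists>no. \<forall>n\<ge>no. norm (ln (measure_pmf.prob (p n) {x. X n x \<le> t n}) / v n - (A \<theta> + \<theta> * \<tau>)) < \<delta>"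
    unfolding Q_def by (simp add: eventually_sequentially)
qed

section \<open>Exponential moments of the triangle count\<close>

lemma finite_nsets_lessThan: "finite (nsets {..<n::nat} k)"
  by (rule finite_imp_finite_nsets) simp

lemma set_erdos_renyi: "set_pmf (erdos_renyi n p) \<subseteq> Pow (nsets {..<n} 2)"
  unfolding erdos_renyi_def by auto

lemma pmf_erdos_renyi:
  assumes p: "0 \<le> p" "p \<le> 1" and G: "G \<subseteq> nsets {..<n} 2"
  shows "pmf (erdos_renyi n p) G = p ^ card G * (1 - p) ^ ((n choose 2) - card G)"
proof -
  let ?P = "nsets {..<n} 2"
  let ?M = "Pi_pmf ?P False (\<lambda>_. bernoulli_pmf p)"
  let ?S = "\<lambda>present. {e \<in> ?P. present e}"
  have "pmf (erdos_renyi n p) G = measure_pmf.prob ?M (?S -` {G})"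
    unfolding erdos_renyi_def by (rule pmf_map)
  also have "\<dots> = measure_pmf.prob ?M {\<lambda>e. e \<in> G}"
  \<comment> \<open>Many functions are sent to \<open>G\<close>, but every one except its indicator
    is true somewhere outside the pairs and has probability 0 under \<open>Pi_pmf\<close>.\<close>
  proof (rule measure_prob_cong_0)
    fix f assume f: "f \<in> ?S -` {G} - {\<lambda>e. e \<in> G}"
    have "\<exists>e. e \<notin> ?P \<and> f e"
    proof (rule ccontr)
      assume "\<not> ?thesis"
      then have "f = (\<lambda>e. e \<in> ?S f)" by auto
      with f show False by auto
    qed
    then show "pmf ?M f = 0"
      using pmf_Pi_outside[OF finite_nsets_lessThan, of n 2 f False "\<lambda>_. bernoulli_pmf p"] by blast
  next
    fix f assume "f \<in> {\<lambda>e. e \<in> G} - ?S -` {G}"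
    then show "pmf ?M f = 0" using G by auto
  qed
  also have "\<dots> = pmf ?M (\<lambda>e. e \<in> G)" by (rule measure_pmf_single)
  also have "\<dots> = (\<Prod>e\<in>?P. pmf (bernoulli_pmf p) (e \<in> G))"
    using G by (intro pmf_Pi' finite_nsets_lessThan) auto
  also have "\<dots> = (\<Prod>e\<in>?P - G. pmf (bernoulli_pmf p) (e \<in> G)) * (\<Prod>e\<in>G. pmf (bernoulli_pmf p) (e \<in> G))"
    by (rule prod.subset_diff[OF G finite_nsets_lessThan])
  also have "(\<Prod>e\<in>?P - G. pmf (bernoulli_pmf p) (e \<in> G)) = (\<Prod>e\<in>?P - G. 1 - p)"
    by (rule prod.cong) (use p in auto)
  also have "\<dots> = (1 - p) ^ ((n choose 2) - card G)"
    using card_Diff_subset[OF finite_subset[OF G finite_nsets_lessThan] G]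
    by (simp only: prod_constant card_nsets_lessThan)
  also have "(\<Prod>e\<in>G. pmf (bernoulli_pmf p) (e \<in> G)) = (\<Prod>e\<in>G. p)"
    by (rule prod.cong) (use p in auto)
  finally show ?thesis by (simp add: mult.commute)
qed

lemma expectation_erdos_renyi:
  assumes "0 \<le> p" "p \<le> 1"
  shows "measure_pmf.expectation (erdos_renyi n p) f
    = (\<Sum>G\<in>Pow (nsets {..<n} 2). p ^ card G * (1 - p) ^ ((n choose 2) - card G) * f G)"
proof -
  have "measure_pmf.expectation (erdos_renyi n p) f
      = (\<Sum>G\<in>Pow (nsets {..<n} 2). f G * pmf (erdos_renyi n p) G)"
    by (rule integral_measure_pmf_real) (use set_erdos_renyi[of n p] finite_nsets_lessThan[of n 2] in auto)
  also have "\<dots> = (\<Sum>G\<in>Pow (nsets {..<n} 2). p ^ card G * (1 - p) ^ ((n choose 2) - card G) * f G)"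
    by (intro sum.cong refl) (use assms in \<open>simp add: pmf_erdos_renyi mult.commute\<close>)
  finally show ?thesis .
qed

lemma prob_edges_present:
  assumes p: "0 \<le> p" "p \<le> 1" and A: "A \<subseteq> nsets {..<n} 2"
  shows "measure_pmf.prob (erdos_renyi n p) {G. A \<subseteq> G} = p ^ card A"
proof -
  let ?P = "nsets {..<n} 2"
  let ?M = "Pi_pmf ?P False (\<lambda>_. bernoulli_pmf p)"
  have "measure_pmf.prob (erdos_renyi n p) {G. A \<subseteq> G}
      = measure_pmf.prob ?M (Pi ?P (\<lambda>e. if e \<in> A then {True} else UNIV))"
    unfolding erdos_renyi_def measure_map_pmf
    by (rule arg_cong[where f = "measure_pmf.prob ?M"]) (use A in \<open>auto simp: Pi_def\<close>)
  also have "\<dots> = (\<Prod>e\<in>?P. measure_pmf.prob (bernoulli_pmf p) (if e \<in> A then {True} else UNIV))"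
    by (rule measure_Pi_pmf_Pi[OF finite_nsets_lessThan])
  also have "\<dots> = (\<Prod>e\<in>?P. if e \<in> A then p else 1)"
    by (rule prod.cong) (use p in \<open>auto simp: measure_pmf_single\<close>)
  also have "\<dots> = (\<Prod>e\<in>A. p)"
    using finite_nsets_lessThan[of n 2] A
    by (intro prod.mono_neutral_cong_right) auto
  finally show ?thesis by simp
qed

lemma expected_triangles_eq:
  assumes p: "0 \<le> p" "p \<le> 1"
  shows "expected_triangles n p = real (n choose 3) * p ^ 3"
proof -
  let ?E = "measure_pmf.expectation (erdos_renyi n p)"
  have card3: "card T = 3" if "T \<in> triangles n" for T
    using that unfolding triangles_eq by (auto simp: tri_def doubleton_eq_iff)
  have int: "integrable (measure_pmf (erdos_renyi n p)) (indicator {G. T \<subseteq> G} :: _ \<Rightarrow> real)" for T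
    by (rule measure_pmf.integrable_const_bound[where B = 1]) (auto split: split_indicator)
  have "expected_triangles n p = ?E (\<lambda>G. \<Sum>T\<in>triangles n. indicator {G. T \<subseteq> G} G)"
    unfolding expected_triangles_def triangle_count_eq
    by (simp add: indicator_def sum.If_cases Int_def)
  also have "\<dots> = (\<Sum>T\<in>triangles n. ?E (indicator {G. T \<subseteq> G}))"
    by (rule Bochner_Integration.integral_sum) (rule int)
  also have "\<dots> = (\<Sum>T\<in>triangles n. p ^ 3)"
    by (intro sum.cong refl) (simp add: prob_edges_present[OF p triangle_subset] card3)
  finally show ?thesis by (simp add: card_triangles)
qed

text \<open>Factor (1 - p)^(n choose 2) out of the edge weights: each present edge then carries the
  odds p / (1 - p), which is the activity of the gas.\<close>

lemma expectation_power_triangle_count: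
  assumes p: "0 \<le> p" "p < 1" and q: "0 < q" "q \<le> 1"
  shows "measure_pmf.expectation (erdos_renyi n p) (\<lambda>G. q ^ triangle_count n G)
    = (1 - p) ^ (n choose 2) * hypergraph_gas.Z (nsets {..<n} 2) q (p / (1 - p)) {} (triangles n)"
proof -
  interpret triangle_gas n q
    by unfold_locales (use q in \<open>auto intro: finite_imp_finite_nsets\<close>)
  have "measure_pmf.expectation (erdos_renyi n p) (\<lambda>G. q ^ triangle_count n G)
    = (\<Sum>G\<in>Pow pairs. p ^ card G * (1 - p) ^ ((n choose 2) - card G) * q ^ triangle_count n G)"
    using p by (intro expectation_erdos_renyi) auto
  also have "\<dots> = (\<Sum>G\<in>Pow pairs. (1 - p) ^ (n choose 2) * ((p / (1 - p)) ^ card G * q ^ triangle_count n G))"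
  proof (intro sum.cong refl)
    fix G assume "G \<in> Pow pairs"
    then have "card G \<le> n choose 2"
      using card_mono[OF finite_nsets_lessThan, of G n 2] by (simp only: card_nsets_lessThan Pow_iff)
    then have "(1 - p) ^ (n choose 2) = (1 - p) ^ ((n choose 2) - card G) * (1 - p) ^ card G"
      by (simp flip: power_add)
    then show "p ^ card G * (1 - p) ^ ((n choose 2) - card G) * q ^ triangle_count n G
        = (1 - p) ^ (n choose 2) * ((p / (1 - p)) ^ card G * q ^ triangle_count n G)"
      using p by (simp add: power_divide)
  qed
  finally show ?thesis
    unfolding Z_def sum_distrib_left by (simp add: triangle_count_eq)
qed

lemma expected_triangles_scaled_tendsto:
  assumes "0 \<le> c"
  shows "(\<lambda>n. expected_triangles n (c / sqrt (real n)) / real n powr (3/2)) \<longlonglongrightarrow> c ^ 3 / 6"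
proof -
  have "(\<lambda>n. c ^ 3 * (1 - inverse (real n)) * (1 - 2 * inverse (real n)) / 6) \<longlonglongrightarrow> c ^ 3 * (1 - 0) * (1 - 2 * 0) / 6"
    by (intro tendsto_intros tendsto_inverse_0_at_top filterlim_real_sequentially) simp
  moreover have "\<forall>\<^sub>F n in sequentially. c\<^sup>2 < real n"
    using filterlim_real_sequentially unfolding filterlim_at_top_dense by blast
  then have "\<forall>\<^sub>F n in sequentially. c ^ 3 * (1 - inverse (real n)) * (1 - 2 * inverse (real n)) / 6
      = expected_triangles n (c / sqrt (real n)) / real n powr (3/2)"
    using eventually_ge_at_top[of 3]
  proof eventually_elim
    case (elim n)
    define r where "r = sqrt (real n)"
    have r: "0 < r" "r * r = real n" using elim unfolding r_def by auto
    have "c \<le> r" unfolding r_def using elim(1) assms by (intro real_le_rsqrt) simp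
    then have p: "0 \<le> c / r" "c / r \<le> 1" using r assms by simp_all
    have "real n powr (3/2) = real n powr (1 + 1/2)" by simp
    also have "\<dots> = real n * r" using elim unfolding r_def by (subst powr_add) (simp add: powr_half_sqrt)
    finally have pw: "real n powr (3/2) = r * r * r" using r by simp
    have "real (n choose 3) = real n * (real n - 1) * (real n - 2) / 6"
      unfolding binomial_gbinomial gbinomial_prod_rev by (simp add: numeral_3_eq_3)
    then have ch: "real (n choose 3) = r * r * (r * r - 1) * (r * r - 2) / 6" using r by simp
    show ?case unfolding r_def[symmetric] expected_triangles_eq[OF p] ch pw unfolding r(2)[symmetric]
      using r(1) by (simp add: field_simps power3_eq_cube)
  qed
  ultimately show ?thesis by (auto intro: Lim_transform_eventually)
qed

text \<open>The term - c / 2 is the limit of the prefactor (1 - p)^(n choose 2); the rest is the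
  partition function at activity p / (1 - p), which is again asymptotic to c / sqrt n.\<close>

lemma ln_expectation_power_tendsto:
  assumes q: "0 < q" "q \<le> 1" and c: "0 \<le> c"
    and a: "a = (1 - q) * c\<^sup>2" "2 * a < 1"
    and y: "y = exp (- (a * y\<^sup>2))"
  shows "(\<lambda>n. ln (measure_pmf.expectation (erdos_renyi n (c / sqrt (real n)))
      (\<lambda>G. q ^ triangle_count n G)) / real n powr (3/2)) \<longlonglongrightarrow> c / 2 * (y + 2 / 3 * a * y ^ 3) - c / 2"
proof -
  define p where "p n = c / sqrt (real n)" for n
  \<comment> \<open>For small n, \<open>p n\<close> may reach or exceed 1 and the odds make no
    sense; the value 0 keeps \<open>L n\<close> nonnegative for every n, as the partition function
    asymptotics require.\<close>
  define L where "L n = (if p n < 1 then p n / (1 - p n) else 0)" for n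
  have p0: "0 \<le> p n" for n unfolding p_def using c by simp
  have p_lim: "(\<lambda>n. sqrt (real n) * p n) \<longlonglongrightarrow> c"
  proof (rule Lim_transform_eventually[OF tendsto_const])
    show "\<forall>\<^sub>F n in sequentially. c = sqrt (real n) * p n"
      using eventually_gt_at_top[of 0] by eventually_elim (simp add: p_def)
  qed
  have p_0: "p \<longlonglongrightarrow> 0" by (rule tendsto_zero_of_sqrt_scaled[OF p_lim])
  then have p_small: "\<forall>\<^sub>F n in sequentially. p n < 1" by (rule order_tendstoD) simp
  have L0: "0 \<le> L n" for n unfolding L_def using p0 by simp
  have "(\<lambda>n. sqrt (real n) * p n / (1 - p n)) \<longlonglongrightarrow> c / (1 - 0)"
    by (intro tendsto_intros p_lim p_0) simp
  moreover have "\<forall>\<^sub>F n in sequentially. sqrt (real n) * p n / (1 - p n) = sqrt (real n) * L n"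
    using p_small by eventually_elim (simp add: L_def)
  ultimately have L: "(\<lambda>n. sqrt (real n) * L n) \<longlonglongrightarrow> c" by (auto intro: Lim_transform_eventually)
  have ln1: "(\<lambda>n. real (n choose 2) * ln (1 - p n) / real n powr (3/2)) \<longlonglongrightarrow> - c / 2"
  proof (rule tendsto_pairs_scaled)
    have "(\<lambda>n. (1 - p n) ^ n) \<longlonglongrightarrow> exp 0 \<or> True" by simp
    have "(\<lambda>n. sqrt (real n) * p n * (1 + 2 * p n)) \<longlonglongrightarrow> c * (1 + 2 * 0)"
      by (intro tendsto_intros p_lim p_0)
    then have up: "(\<lambda>n. - (sqrt (real n) * p n * (1 + 2 * p n))) \<longlonglongrightarrow> - c"
      by (auto intro: tendsto_minus)
    have lo: "(\<lambda>n. - (sqrt (real n) * p n)) \<longlonglongrightarrow> - c" by (intro tendsto_minus p_lim)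
    have half: "\<forall>\<^sub>F n in sequentially. p n < 1/2" by (rule order_tendstoD(2)[OF p_0]) simp
    show "(\<lambda>n. sqrt (real n) * ln (1 - p n)) \<longlonglongrightarrow> - c"
    proof (rule real_tendsto_sandwich[OF _ _ up lo])
      show "\<forall>\<^sub>F n in sequentially. - (sqrt (real n) * p n * (1 + 2 * p n)) \<le> sqrt (real n) * ln (1 - p n)"
        using half
      proof eventually_elim
        case (elim n)
        have "- p n - 2 * (p n)\<^sup>2 \<le> ln (1 - p n)"
          using elim p0[of n] by (intro ln_one_minus_pos_lower_bound) auto
        then have "sqrt (real n) * (- p n - 2 * (p n)\<^sup>2) \<le> sqrt (real n) * ln (1 - p n)"
          by (intro mult_left_mono) auto
        then show ?case by (simp add: algebra_simps power2_eq_square)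
      qed
      show "\<forall>\<^sub>F n in sequentially. sqrt (real n) * ln (1 - p n) \<le> - (sqrt (real n) * p n)"
        using half
      proof eventually_elim
        case (elim n)
        have "ln (1 - p n) \<le> - p n" using elim ln_le_minus_one[of "1 - p n"] by simp
        then have "sqrt (real n) * ln (1 - p n) \<le> sqrt (real n) * (- p n)"
          by (intro mult_left_mono) auto
        then show ?case by simp
      qed
    qed
  qed
  have "(\<lambda>n. real (n choose 2) * ln (1 - p n) / real n powr (3/2) +
      ln (hypergraph_gas.Z (nsets {..<n} 2) q (L n) {} (triangles n)) / real n powr (3/2))
      \<longlonglongrightarrow> - c / 2 + c / 2 * (y + 2 / 3 * a * y ^ 3)"
    by (intro tendsto_add ln1 ln_partition_function_tendsto q L0 L a y)
  moreover have "\<forall>\<^sub>F n in sequentially. real (n choose 2) * ln (1 - p n) / real n powr (3/2) +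
      ln (hypergraph_gas.Z (nsets {..<n} 2) q (L n) {} (triangles n)) / real n powr (3/2)
    = ln (measure_pmf.expectation (erdos_renyi n (p n)) (\<lambda>G. q ^ triangle_count n G)) / real n powr (3/2)"
    using p_small
  proof eventually_elim
    case (elim n)
    interpret triangle_gas n q
      by unfold_locales (use q in \<open>auto intro: finite_imp_finite_nsets\<close>)
    have Lp: "L n = p n / (1 - p n)" using elim unfolding L_def by simp
    have "ln ((1 - p n) ^ (n choose 2) * Z (L n) {} (triangles n))
        = ln ((1 - p n) ^ (n choose 2)) + ln (Z (L n) {} (triangles n))"
      using elim Z_pos[OF L0[of n], of "{}" "triangles n"] by (intro ln_mult_pos) auto
    then show ?case
      unfolding expectation_power_triangle_count[OF p0 elim q] Lp[symmetric]
      using elim by (simp add: ln_realpow add_divide_distrib)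
  qed
  ultimately have "(\<lambda>n. ln (measure_pmf.expectation (erdos_renyi n (p n)) (\<lambda>G. q ^ triangle_count n G)) / real n powr (3/2))
      \<longlonglongrightarrow> - c / 2 + c / 2 * (y + 2 / 3 * a * y ^ 3)"
    by (rule Lim_transform_eventually)
  then show ?thesis unfolding p_def by simp
qed

section \<open>Tilting and the rate of the lower tail\<close>

text \<open>At a real centre with real increment h, the real part passes through the powers of h, so
  the real parts of the Taylor coefficients form a real power series for f.\<close>

lemma real_analytic_on_Re_holomorphic:
  assumes "\<And>x. x \<in> S \<Longrightarrow> \<exists>F r. 0 < r \<and> F holomorphic_on ball (of_real x) r \<and>
      (\<forall>h. \<bar>h\<bar> < r \<longrightarrow> f (x + h) = Re (F (of_real (x + h))))"
  shows "real_analytic_on f S"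
  unfolding real_analytic_on_def
proof
  fix x assume "x \<in> S"
  then obtain F r where r: "0 < r" and F: "F holomorphic_on ball (of_real x) r"
    and f: "\<And>h. \<bar>h\<bar> < r \<Longrightarrow> f (x + h) = Re (F (of_real (x + h)))" using assms by blast
  define A where "A = Abs_fps (\<lambda>n. Re ((deriv ^^ n) F (of_real x) / fact n))"
  have sums: "(\<lambda>n. fps_nth A n * h ^ n) sums f (x + h)" if h: "\<bar>h\<bar> < r" for h
  proof -
    have "complex_of_real (x + h) \<in> ball (of_real x) r" using h by (simp add: dist_norm)
    from holomorphic_power_series[OF F this]
    have "(\<lambda>n. (deriv ^^ n) F (of_real x) / fact n * (of_real h) ^ n) sums F (of_real (x + h))" by simp
    from sums_Re[OF this]
    have "(\<lambda>n. Re ((deriv ^^ n) F (of_real x) / fact n * of_real h ^ n)) sums f (x + h)"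
      unfolding f[OF h] .
    moreover have "Re (z * of_real h ^ n) = Re z * h ^ n" for z n by (simp flip: of_real_power)
    ultimately show ?thesis unfolding A_def by (simp only: fps_nth_Abs_fps)
  qed
  have "ereal r \<le> conv_radius (fps_nth A)"
  proof (rule conv_radius_geI_ex')
    fix s assume "0 < s" "ereal s < ereal r"
    then show "summable (\<lambda>n. fps_nth A n * of_real s ^ n)" using sums[of s] by (simp add: sums_iff)
  qed
  moreover have "0 < ereal r" using r by simp
  ultimately have "0 < fps_conv_radius A" unfolding fps_conv_radius_def by (rule order_less_le_trans[rotated])
  moreover have "\<forall>\<^sub>F h in nhds 0. eval_fps A h = f (x + h)"
    unfolding eventually_nhds_metric
  proof (intro exI[of _ r] conjI allI impI r)
    fix h :: real assume "dist h 0 < r"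
    then show "eval_fps A h = f (x + h)" using sums[of h] by (simp add: eval_fps_def sums_iff)
  qed
  ultimately show "\<exists>F. (\<lambda>h. f (x + h)) has_fps_expansion F" unfolding has_fps_expansion_def by blast
qed

text \<open>Eliminates the Lambert function: with w = W(2/e), the equation w e^w = 2/e gives w /
  (2/e) = e^(- w).\<close>

lemma eta_star_eq:
  obtains w where "0 < w" "w * exp w = 2 / exp 1" "eta_star = exp (- (3/2 * w))"
proof -
  let ?f = "\<lambda>x::real. x * exp x"
  have inj: "inj_on ?f {0..}"
  proof (rule strict_mono_on_imp_inj_on, rule strict_mono_onI)
    fix r s :: real assume "r \<in> {0..}" "s \<in> {0..}" "r < s"
    then show "?f r < ?f s" by (intro mult_strict_mono) auto
  qed
  have e: "2 \<le> exp (1::real)" using exp_ge_add_one_self[of 1] by simp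
  have "\<exists>x\<ge>0. x \<le> 1 \<and> ?f x = 2 / exp 1"
  proof (rule IVT')
    have "2 / exp (1::real) \<le> 1" using e by simp
    then show "2 / exp 1 \<le> ?f 1" using e by linarith
  qed (auto intro!: continuous_intros)
  then have im: "2 / exp 1 \<in> ?f ` {0..}" by force
  have W: "lambert_W (2 / exp 1) * exp (lambert_W (2 / exp 1)) = 2 / exp 1"
    unfolding lambert_W_def by (rule f_the_inv_into_f[OF inj im])
  have W0: "0 \<le> lambert_W (2 / exp 1)"
    using the_inv_into_into[OF inj im order_refl] unfolding lambert_W_def by simp
  have Wn: "lambert_W (2 / exp 1) \<noteq> 0"
  proof
    assume "lambert_W (2 / exp 1) = 0"
    then show False using W by simp
  qed
  show thesis
  proof
    show "0 < lambert_W (2 / exp 1)" using W0 Wn by simp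
    show "lambert_W (2 / exp 1) * exp (lambert_W (2 / exp 1)) = 2 / exp 1" by (rule W)
    have "w / (w * exp w) = exp (- w)" if "w \<noteq> 0" for w :: real
      using that by (simp add: exp_minus divide_inverse)
    from this[OF Wn] have "lambert_W (2 / exp 1) / (2 / exp 1) = exp (- lambert_W (2 / exp 1))"
      unfolding W .
    then show "eta_star = exp (- (3/2 * lambert_W (2 / exp 1)))"
      unfolding eta_star_def by (simp add: exp_powr_real mult.commute)
  qed
qed

lemma eta_star_pos: "0 < eta_star"
proof -
  obtain w where w: "eta_star = exp (- (3/2 * w))" by (rule eta_star_eq)
  show ?thesis unfolding w by (rule exp_gt_zero)
qed

text \<open>At the saddle point the left-hand side is \<open>2 a\<close>, and \<open>eta_star\<close> is the value of \<open>y\<^sup>3\<close> at \<open>a = 1/e\<close>.\<close>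

lemma eta_star_contraction:
  assumes "eta_star \<le> \<eta>" "\<eta> < y ^ 3" "0 < y" "y \<le> 1"
  shows "2 * (- ln y / y\<^sup>2) < 1"
proof -
  obtain w where w: "0 < w" "w * exp w = 2 / exp 1" "eta_star = exp (- (3/2 * w))"
    by (rule eta_star_eq)
  \<comment> \<open>This one inequality gives both - ln y < w / 2 and y^2 > e^(- w); the quotient is
    then at most w e^w / 2 = 1/e.\<close>
  have "exp (- (3/2 * w)) < y ^ 3" using assms w(3) by linarith
  then have "ln (exp (- (3/2 * w))) < ln (y ^ 3)" by (rule ln_strict_mono) simp
  then have 1: "- ln y < w / 2" using assms by (simp add: ln_realpow)
  then have "exp (- w) < exp (2 * ln y)" by (subst exp_less_cancel_iff) linarith
  also have "\<dots> = y\<^sup>2" using assms(3) by (simp add: exp_double)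
  finally have 2: "exp (- w) < y\<^sup>2" .
  have "- ln y / y\<^sup>2 \<le> (w / 2) / exp (- w)"
    using 1 2 assms w by (intro frac_le) (auto simp: ln_le_zero_iff)
  also have "\<dots> = (w * exp w) / 2" by (simp add: exp_minus field_simps)
  also have "\<dots> = 1 / exp 1" unfolding w(2) by simp
  finally have "- ln y / y\<^sup>2 \<le> 1 / exp 1" .
  moreover have "1 / exp (1::real) < 1 / 2"
    using exp_lower_Taylor_quadratic[of 1] by (intro frac_less2) auto
  ultimately show ?thesis by linarith
qed

text \<open>The triangle weight \<open>q\<close> for which \<open>y\<close> solves \<open>y = exp (- (1 - q) c\<^sup>2 y\<^sup>2)\<close>.\<close>

definition tilt :: "real \<Rightarrow> real \<Rightarrow> real" where
  "tilt c y = 1 + ln y / (c\<^sup>2 * y\<^sup>2)"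

text \<open>The limit in \<open>ln_expectation_power_tendsto\<close> at q = \<open>tilt c y\<close>,
  with a y^2 replaced by - ln y.\<close>

definition tilted_pressure :: "real \<Rightarrow> real \<Rightarrow> real" where
  "tilted_pressure c y = c / 2 * (y - 1) - c / 3 * (y * ln y)"

text \<open>Minus the derivative of the pressure with respect to the exponent - ln q: the triangle
  count under the tilted measure in units of n^(3/2). Each of the three edges is thinned by y, and
  the triangle itself costs q.\<close>

definition tilted_mean :: "real \<Rightarrow> real \<Rightarrow> real" where
  "tilted_mean c y = c ^ 3 / 6 * (y ^ 3 * tilt c y)"

text \<open>Both - ln y and 1 / y^2 decrease on the unit interval. Hence y can serve as the
  parameter of the tilt, with smaller y meaning a stronger tilt.\<close>

lemma tilt_strict_mono:
  assumes "0 < c" "0 < x" "x < y" "y \<le> 1"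
  shows "tilt c x < tilt c y"
proof -
  have "- ln y / y\<^sup>2 < - ln x / x\<^sup>2"
    using assms by (intro frac_less) (auto simp: power_mono)
  then have "(- ln y / y\<^sup>2) / c\<^sup>2 < (- ln x / x\<^sup>2) / c\<^sup>2"
    using assms by (intro divide_strict_right_mono) auto
  then show ?thesis unfolding tilt_def by (simp add: mult.commute)
qed

lemma ln_expectation_tilt_tendsto:
  assumes c: "0 < c" and y: "0 < y" "y \<le> 1" "0 < tilt c y" "2 * (- ln y / y\<^sup>2) < 1"
  shows "(\<lambda>n. ln (measure_pmf.expectation (erdos_renyi n (c / sqrt (real n)))
      (\<lambda>G. exp (- (- ln (tilt c y) * real (triangle_count n G))))) / real n powr (3/2)) \<longlonglongrightarrow> tilted_pressure c y"
proof -
  define a where "a = - ln y / y\<^sup>2"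
  have q: "0 < tilt c y" "tilt c y \<le> 1"
    using y c unfolding tilt_def by (auto simp: divide_nonpos_pos)
  have a: "a = (1 - tilt c y) * c\<^sup>2" "2 * a < 1" using c y unfolding a_def tilt_def by auto
  have ay: "a * y\<^sup>2 = - ln y" unfolding a_def using y by simp
  then have fp: "y = exp (- (a * y\<^sup>2))" using y by simp
  have "y ^ 3 = y\<^sup>2 * y" by (simp add: power3_eq_cube power2_eq_square)
  then have y3: "2 / 3 * a * y ^ 3 = 2 / 3 * (a * y\<^sup>2) * y" by simp
  have "c / 2 * (y + 2 / 3 * a * y ^ 3) - c / 2 = tilted_pressure c y"
    unfolding y3 ay tilted_pressure_def by (simp add: algebra_simps)
  moreover have "exp (- (- ln (tilt c y) * real k)) = tilt c y ^ k" for k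
    using q by (simp add: exp_of_nat2_mult)
  ultimately show ?thesis
    using ln_expectation_power_tendsto[OF q less_imp_le[OF c] a fp] by (simp only:)
qed

text \<open>Cauchy's mean value theorem for the pressure against the exponent - ln q, both
  parametrised by y: secant slopes become values of \<open>tilted_mean\<close>.\<close>

lemma tilted_slope:
  assumes c: "0 < c" and xy: "0 < x" "x < y" "y \<le> 1" "0 < tilt c x"
  obtains z where "x < z" "z < y"
    "tilted_pressure c y - tilted_pressure c x = tilted_mean c z * (- ln (tilt c x) - - ln (tilt c y))"
proof -
  have pos: "0 < tilt c z" if "x \<le> z" "z \<le> y" for z
    using tilt_strict_mono[OF c xy(1), of z] that xy by (cases "x = z") auto
  define T' where "T' z = - ((1 - 2 * ln z) / (c\<^sup>2 * z ^ 3) / tilt c z)" for z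
  define P' where "P' z = c / 6 * (1 - 2 * ln z)" for z
  have T: "((\<lambda>z. - ln (tilt c z)) has_real_derivative T' z) (at z)" if "x \<le> z" "z \<le> y" for z
  proof -
    have z: "0 < z" using that xy by simp
    have "((tilt c) has_real_derivative (1 - 2 * ln z) / (c\<^sup>2 * z ^ 3)) (at z)"
      unfolding tilt_def using z c
      by (auto intro!: derivative_eq_intros simp: field_simps power2_eq_square power3_eq_cube)
    then show ?thesis unfolding T'_def using pos[OF that] by (auto intro!: derivative_eq_intros)
  qed
  have P: "(tilted_pressure c has_real_derivative P' z) (at z)" if "x \<le> z" "z \<le> y" for z
  proof -
    have z: "0 < z" using that xy by simp
    then show ?thesis unfolding tilted_pressure_def P'_def
      by (auto intro!: derivative_eq_intros simp: field_simps)
  qed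
  have "\<exists>z. x < z \<and> z < y \<and> (tilted_pressure c y - tilted_pressure c x) * T' z
      = (- ln (tilt c y) - - ln (tilt c x)) * P' z"
    by (rule GMVT'[OF xy(2)]) (use T P in \<open>auto intro!: DERIV_isCont\<close>)
  then obtain z where z: "x < z" "z < y"
    and eq: "(tilted_pressure c y - tilted_pressure c x) * T' z = (- ln (tilt c y) - - ln (tilt c x)) * P' z" by blast
  have "ln z < 0" using z xy by simp
  then have P'pos: "0 < P' z" unfolding P'_def using c by simp
  have "tilted_mean c z * T' z = - P' z"
  proof -
    have "z ^ 3 * tilt c z \<noteq> 0" "c \<noteq> 0" "z \<noteq> 0" using z xy pos[of z] c by auto
    then show ?thesis unfolding tilted_mean_def T'_def P'_def
      by (simp add: field_simps power2_eq_square power3_eq_cube)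
  qed
  then have "(tilted_pressure c y - tilted_pressure c x) * P' z
      = tilted_mean c z * (- ln (tilt c x) - - ln (tilt c y)) * P' z"
    using eq by algebra
  then have "tilted_pressure c y - tilted_pressure c x = tilted_mean c z * (- ln (tilt c x) - - ln (tilt c y))"
    using P'pos by simp
  with z that show thesis by blast
qed

lemma tilted_mean_strict_mono:
  assumes "0 < c" "0 < x" "x < y" "y \<le> 1" "0 < tilt c x"
  shows "tilted_mean c x < tilted_mean c y"
  unfolding tilted_mean_def using assms tilt_strict_mono[OF assms(1-4)]
  by (intro mult_strict_left_mono mult_strict_mono) (auto intro!: power_strict_mono)

text \<open>The saddle point condition q y^3 = \<eta> makes the tilted mean equal to \<eta> c^3 / 6,
  the limit of the scaled threshold.\<close>

lemma lower_tail_rate_tendsto: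
  assumes \<eta>: "eta_star \<le> \<eta>" and c: "0 < c"
    and y: "0 < y" "y < 1" "\<eta> < y ^ 3" and q: "tilt c y = \<eta> / y ^ 3"
  shows "lower_tail_rate \<eta> c \<longlonglongrightarrow> tilted_pressure c y + - ln (tilt c y) * (\<eta> * c ^ 3 / 6)"
proof -
  have \<eta>0: "0 < \<eta>" using eta_star_pos \<eta> by (rule order_less_le_trans)
  have qpos: "0 < tilt c y" unfolding q using \<eta>0 y by simp
  have mean: "tilted_mean c y = \<eta> * c ^ 3 / 6" unfolding tilted_mean_def q using y by simp
  define v where "v n = real n powr (3/2)" for n
  define E where "E n \<alpha> = measure_pmf.expectation (erdos_renyi n (c / sqrt (real n)))
      (\<lambda>G. exp (- (\<alpha> * real (triangle_count n G))))" for n \<alpha>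
  \<comment> \<open>The limits are known as functions of y, but a function of the exponent is
    needed. Defining it as a limit avoids inverting \<open>tilt\<close>.\<close>
  define A where "A \<alpha> = lim (\<lambda>n. ln (E n \<alpha>) / v n)" for \<alpha>
  define Y where "Y = {x. 0 < x \<and> x \<le> y \<and> 0 < tilt c x \<and> 2 * (- ln x / x\<^sup>2) < 1}"
  have yY: "y \<in> Y" unfolding Y_def using y qpos eta_star_contraction[OF \<eta> y(3)] by auto
  have lim: "(\<lambda>n. ln (E n (- ln (tilt c x))) / v n) \<longlonglongrightarrow> tilted_pressure c x" if "x \<in> Y" for x
    using ln_expectation_tilt_tendsto[OF c, of x] that y unfolding E_def v_def Y_def by auto
  have A: "A (- ln (tilt c x)) = tilted_pressure c x" if "x \<in> Y" for x
    unfolding A_def by (rule limI[OF lim[OF that]])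
  have tilt1: "tilt c y \<le> 1" using y c unfolding tilt_def by (auto simp: divide_nonpos_pos)
  have v_top: "filterlim v at_top sequentially"
    unfolding v_def
  proof (rule filterlim_at_top_mono[OF filterlim_real_sequentially])
    show "\<forall>\<^sub>F n in sequentially. real n \<le> real n powr (3/2)"
      using eventually_ge_at_top[of 1]
    proof eventually_elim
      case (elim n)
      then show ?case using powr_mono[of 1 "3/2" "real n"] by simp
    qed
  qed
  have "(\<lambda>n. ln (measure_pmf.prob (erdos_renyi n (c / sqrt (real n)))
      {G. real (triangle_count n G) \<le> \<eta> * expected_triangles n (c / sqrt (real n))}) / v n)
      \<longlonglongrightarrow> A (- ln (tilt c y)) + - ln (tilt c y) * (\<eta> * c ^ 3 / 6)"
  proof (rule lower_tail_exponent_tendsto[where S = "(\<lambda>x. - ln (tilt c x)) ` Y"])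
    have "(\<lambda>n. \<eta> * (expected_triangles n (c / sqrt (real n)) / v n)) \<longlonglongrightarrow> \<eta> * (c ^ 3 / 6)"
      unfolding v_def using c by (intro tendsto_mult_left expected_triangles_scaled_tendsto) simp
    then show "(\<lambda>n. \<eta> * expected_triangles n (c / sqrt (real n)) / v n) \<longlonglongrightarrow> \<eta> * c ^ 3 / 6" by simp
    show "(\<lambda>n. ln (measure_pmf.expectation (erdos_renyi n (c / sqrt (real n)))
        (\<lambda>x. exp (- (\<alpha> * real (triangle_count n x))))) / v n) \<longlonglongrightarrow> A \<alpha>"
      if "\<alpha> \<in> (\<lambda>x. - ln (tilt c x)) ` Y" for \<alpha>
      using that lim A unfolding E_def by auto
    show "0 \<le> - ln (tilt c y)" using qpos tilt1 by simp
    show "- ln (tilt c y) \<in> (\<lambda>x. - ln (tilt c x)) ` Y" using yY by blast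
    fix \<epsilon> :: real assume \<epsilon>: "0 < \<epsilon>"
    have cont: "isCont (tilt c) y" "isCont (\<lambda>x. 2 * (- ln x / x\<^sup>2)) y" "isCont (\<lambda>x. - ln (tilt c x)) y"
      "isCont (tilted_mean c) y"
      unfolding tilted_mean_def using y c qpos unfolding tilt_def by (auto intro!: continuous_intros)
    have lim_nhds: "(f \<longlongrightarrow> f y) (nhds y)" if "isCont f y" for f :: "real \<Rightarrow> real"
      using that unfolding isCont_def tendsto_at_iff_tendsto_nhds .
    have "\<forall>\<^sub>F x in nhds y. 0 < x \<and> 0 < tilt c x \<and> 2 * (- ln x / x\<^sup>2) < 1 \<and>
        - ln (tilt c x) < - ln (tilt c y) + \<epsilon> \<and> \<eta> * c ^ 3 / 6 - \<epsilon> < tilted_mean c x"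
    proof (intro eventually_conj)
      show "\<forall>\<^sub>F x in nhds y. 0 < x" using y by (intro order_tendstoD(1)[OF filterlim_ident])
      show "\<forall>\<^sub>F x in nhds y. 0 < tilt c x"
        by (rule order_tendstoD(1)[OF lim_nhds[OF cont(1)] qpos])
      show "\<forall>\<^sub>F x in nhds y. 2 * (- ln x / x\<^sup>2) < 1"
        by (rule order_tendstoD(2)[OF lim_nhds[OF cont(2)]]) (use yY in \<open>simp add: Y_def\<close>)
      show "\<forall>\<^sub>F x in nhds y. - ln (tilt c x) < - ln (tilt c y) + \<epsilon>"
        by (rule order_tendstoD(2)[OF lim_nhds[OF cont(3)]]) (use \<epsilon> in simp)
      show "\<forall>\<^sub>F x in nhds y. \<eta> * c ^ 3 / 6 - \<epsilon> < tilted_mean c x"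
        by (rule order_tendstoD(1)[OF lim_nhds[OF cont(4)]]) (use \<epsilon> mean in simp)
    qed
    then obtain d where d: "0 < d" and near: "\<And>x. \<bar>x - y\<bar> < d \<Longrightarrow> 0 < x \<and> 0 < tilt c x \<and> 2 * (- ln x / x\<^sup>2) < 1 \<and>
        - ln (tilt c x) < - ln (tilt c y) + \<epsilon> \<and> \<eta> * c ^ 3 / 6 - \<epsilon> < tilted_mean c x"
      unfolding eventually_nhds_metric dist_real_def by blast
    \<comment> \<open>Lowering y raises the exponent - ln (tilt c y), so \<open>y1\<close> and
      \<open>y2\<close> provide \<alpha> < \<beta>. They and all points between them and y stay
      within distance d of y.\<close>
    define y1 y2 where "y1 = y - d / 3" and "y2 = y - d / 2"
    have o: "y2 < y1" "y1 < y" using d unfolding y1_def y2_def by auto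
    have n1: "\<bar>y1 - y\<bar> < d" and n2: "\<bar>y2 - y\<bar> < d" using d unfolding y1_def y2_def by auto
    have Y12: "y1 \<in> Y" "y2 \<in> Y" using near[OF n1] near[OF n2] o unfolding Y_def by auto
    note p1 = near[OF n1] and p2 = near[OF n2]
    obtain z where z: "y1 < z" "z < y"
      "tilted_pressure c y - tilted_pressure c y1 = tilted_mean c z * (- ln (tilt c y1) - - ln (tilt c y))"
      using tilted_slope[OF c, of y1 y] p1 o y by (auto simp: less_imp_le)
    obtain z' where z': "y2 < z'" "z' < y1"
      "tilted_pressure c y1 - tilted_pressure c y2 = tilted_mean c z' * (- ln (tilt c y2) - - ln (tilt c y1))"
      using tilted_slope[OF c, of y2 y1] p2 o y by (auto simp: less_imp_le)
    have lt: "- ln (tilt c y) < - ln (tilt c y1)" "- ln (tilt c y1) < - ln (tilt c y2)"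
      using tilt_strict_mono[OF c, of y1 y] tilt_strict_mono[OF c, of y2 y1] p1 p2 o y qpos
      by (auto intro!: ln_strict_mono)
    have nz: "\<bar>z - y\<bar> < d" "\<bar>z' - y\<bar> < d" using z z' o d unfolding y1_def y2_def by auto
    \<comment> \<open>The first secant slope is strictly below the target by monotonicity of the
      tilted mean; the second exceeds the target minus \<epsilon> by its continuity at y.\<close>
    have m1: "tilted_mean c z < \<eta> * c ^ 3 / 6"
      using tilted_mean_strict_mono[OF c, of z y] near[OF nz(1)] z y unfolding mean by auto
    have m2: "\<eta> * c ^ 3 / 6 - \<epsilon> < tilted_mean c z'" using near[OF nz(2)] by blast
    show "\<exists>\<alpha>\<in>(\<lambda>x. - ln (tilt c x)) ` Y. \<exists>\<beta>\<in>(\<lambda>x. - ln (tilt c x)) ` Y. - ln (tilt c y) < \<alpha> \<and>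
        \<alpha> < - ln (tilt c y) + \<epsilon> \<and> \<alpha> < \<beta> \<and>
        A (- ln (tilt c y)) - A \<alpha> < \<eta> * c ^ 3 / 6 * (\<alpha> - - ln (tilt c y)) \<and>
        (\<eta> * c ^ 3 / 6 - \<epsilon>) * (\<beta> - \<alpha>) < A \<alpha> - A \<beta>"
    proof (intro bexI conjI)
      show "- ln (tilt c y) < - ln (tilt c y1)" "- ln (tilt c y1) < - ln (tilt c y2)" by (fact lt)+
      show "- ln (tilt c y1) < - ln (tilt c y) + \<epsilon>" using p1 by blast
      show "A (- ln (tilt c y)) - A (- ln (tilt c y1)) < \<eta> * c ^ 3 / 6 * (- ln (tilt c y1) - - ln (tilt c y))"
        unfolding A[OF yY] A[OF Y12(1)] z(3) using m1 lt(1) by (intro mult_strict_right_mono) auto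
      show "(\<eta> * c ^ 3 / 6 - \<epsilon>) * (- ln (tilt c y2) - - ln (tilt c y1)) < A (- ln (tilt c y1)) - A (- ln (tilt c y2))"
        unfolding A[OF Y12(1)] A[OF Y12(2)] z'(3) using m2 lt(2) by (intro mult_strict_right_mono) auto
    qed (use Y12 in blast)+
  qed (simp_all add: v_top)
  then show ?thesis
    unfolding A[OF yY] lower_tail_rate_def lower_tail_prob_def v_def by simp
qed

section \<open>Analyticity of the rate\<close>

text \<open>The equation is \<open>tilt c y = \<eta> / y ^ 3\<close> cleared of denominators. The
  difference h of its sides is negative at the cube root of \<eta> and positive at 1.\<close>

lemma saddle_exists:
  fixes \<eta> c :: real
  assumes \<eta>: "0 < \<eta>" "\<eta> < 1" and c: "0 < c"
  obtains y where "0 < y" "y < 1" "\<eta> < y ^ 3" "c\<^sup>2 * (y ^ 3 - \<eta>) = - y * ln y"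
proof -
  define r where "r = root 3 \<eta>"
  have r: "0 < r" "r < 1" "r ^ 3 = \<eta>" using \<eta> unfolding r_def by auto
  define h where "h y = y * ln y + c\<^sup>2 * (y ^ 3 - \<eta>)" for y
  have "\<exists>y\<ge>r. y \<le> 1 \<and> h y = 0"
  proof (rule IVT')
    show "h r \<le> 0" unfolding h_def r(3) using r by (simp add: mult_nonneg_nonpos ln_le_zero_iff)
    show "0 \<le> h 1" unfolding h_def using \<eta> by simp
    show "continuous_on {r..1} h" unfolding h_def using r by (intro continuous_intros) auto
  qed (use r in simp)
  then obtain y where y: "r \<le> y" "y \<le> 1" "h y = 0" by blast
  have "h r < 0" unfolding h_def r(3) using r by (simp add: mult_pos_neg)
  moreover have "0 < h 1" unfolding h_def using \<eta> c by simp
  ultimately have ry: "r < y" "y < 1" using y by (auto simp: less_le)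
  have 1: "0 < y" using r ry by simp
  have 2: "\<eta> < y ^ 3" unfolding r(3)[symmetric] using ry r by (intro power_strict_mono) auto
  have 3: "c\<^sup>2 * (y ^ 3 - \<eta>) = - y * ln y" using y(3) unfolding h_def by simp
  show thesis by (rule that[OF 1 ry(2) 2 3])
qed

text \<open>The numerator of the derivative is ln z (2 z^3 + \<eta>) - (z^3 - \<eta>), and both
  terms are negative since z < 1 and z^3 > \<eta>.\<close>

lemma saddle_antimono:
  fixes \<eta> x y :: real
  assumes \<eta>: "0 < \<eta>" and xy: "0 < x" "x < y" "y < 1" "\<eta> < x ^ 3"
  shows "- y * ln y / (y ^ 3 - \<eta>) < - x * ln x / (x ^ 3 - \<eta>)"
proof -
  have gt: "\<eta> < z ^ 3" if "x \<le> z" for z using xy power_mono[OF that, of 3] by linarith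
  show ?thesis
  proof (rule DERIV_neg_imp_decreasing[OF xy(2)], intro exI conjI)
    fix z assume z: "x \<le> z" "z \<le> y"
    then have z0: "0 < z" "z < 1" "\<eta> < z ^ 3" using xy gt by auto
    have "((\<lambda>y. - y * ln y / (y ^ 3 - \<eta>)) has_real_derivative
        (- (ln z + 1) * (z ^ 3 - \<eta>) - - z * ln z * (3 * z\<^sup>2)) / ((z ^ 3 - \<eta>) * (z ^ 3 - \<eta>))) (at z)"
    proof (rule DERIV_divide)
      show "((\<lambda>y. - y * ln y) has_real_derivative - (ln z + 1)) (at z)"
        using z0 by (auto intro!: derivative_eq_intros)
      show "((\<lambda>y. y ^ 3 - \<eta>) has_real_derivative 3 * z\<^sup>2) (at z)"
        by (auto intro!: derivative_eq_intros)
    qed (use z0 in simp)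
    moreover have "- (ln z + 1) * (z ^ 3 - \<eta>) - - z * ln z * (3 * z\<^sup>2) = ln z * (2 * z ^ 3 + \<eta>) - (z ^ 3 - \<eta>)"
      by (simp add: algebra_simps power2_eq_square power3_eq_cube)
    ultimately show "((\<lambda>y. - y * ln y / (y ^ 3 - \<eta>)) has_real_derivative
        (ln z * (2 * z ^ 3 + \<eta>) - (z ^ 3 - \<eta>)) / (z ^ 3 - \<eta>)\<^sup>2) (at z)"
      by (simp only: power2_eq_square)
    have "ln z * (2 * z ^ 3 + \<eta>) < 0" using z0 \<eta> by (intro mult_neg_pos add_pos_pos) auto
    then show "(ln z * (2 * z ^ 3 + \<eta>) - (z ^ 3 - \<eta>)) / (z ^ 3 - \<eta>)\<^sup>2 < 0"
      using z0 by (intro divide_neg_pos) auto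
  qed
qed

text \<open>The saddle point extends holomorphically because \<open>c\<^sup>2\<close> has non-vanishing derivative in it.\<close>

lemma saddle_holomorphic:
  fixes \<eta> c0 :: real and Y :: "real \<Rightarrow> real"
  assumes \<eta>: "0 < \<eta>" and c0: "0 < c0"
    and Y: "\<And>c. 0 < c \<Longrightarrow> 0 < Y c \<and> Y c < 1 \<and> \<eta> < Y c ^ 3 \<and> c\<^sup>2 * (Y c ^ 3 - \<eta>) = - Y c * ln (Y c)"
  obtains G r where "0 < r" "r \<le> c0" "G holomorphic_on ball (complex_of_real c0) r"
    "\<And>w. w \<in> ball (complex_of_real c0) r \<Longrightarrow> 0 < Re (G w)"
    "\<And>c. \<bar>c - c0\<bar> < r \<Longrightarrow> G (complex_of_real c) = of_real (Y c)"
proof -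
  define y0 where "y0 = Y c0"
  have y0: "0 < y0" "y0 < 1" "\<eta> < y0 ^ 3" using Y[OF c0] unfolding y0_def by auto
  define k where "k y = - y * ln y / (y ^ 3 - \<eta>)" for y :: real
  have kY: "k (Y c) = c\<^sup>2" if "0 < c" for c
  proof -
    have "Y c ^ 3 - \<eta> \<noteq> 0" using Y[OF that] by auto
    moreover have "k (Y c) = c\<^sup>2 * (Y c ^ 3 - \<eta>) / (Y c ^ 3 - \<eta>)"
      unfolding k_def using Y[OF that] by (simp only:)
    ultimately show ?thesis by simp
  qed
  \<comment> \<open>The right half-plane avoids the branch cut of \<open>Ln\<close>, and the cube
    roots of \<eta> are the poles of f. Since the local inverse takes values in \<open>U\<close>,
    its real part is positive.\<close>
  define U where "U = {z :: complex. 0 < Re z \<and> z ^ 3 \<noteq> of_real \<eta>}"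
  define f where "f z = - z * Ln z / (z ^ 3 - of_real \<eta>)" for z :: complex
  have U: "open U"
  proof -
    have "open {z :: complex. 0 < Re z}" by (rule open_halfspace_Re_gt)
    moreover have "open {z :: complex. z ^ 3 \<noteq> of_real \<eta>}"
      by (intro open_Collect_neq continuous_intros)
    ultimately show ?thesis unfolding U_def by (rule open_Collect_conj)
  qed
  have nonpos: "z \<notin> \<real>\<^sub>\<le>\<^sub>0" if "0 < Re z" for z using that by (auto simp: complex_nonpos_Reals_iff)
  have f: "f holomorphic_on U"
    unfolding f_def using nonpos by (intro holomorphic_intros) (auto simp: U_def)
  have f_real: "f (of_real y) = of_real (k y)" if "0 < y" for y
    unfolding f_def k_def using that by (simp add: Ln_of_real)
  have y0U: "of_real y0 \<in> U" unfolding U_def using y0 by (simp flip: of_real_power)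
  have "deriv f (of_real y0) \<noteq> 0"
  proof -
    have nz: "(complex_of_real y0) ^ 3 \<noteq> of_real \<eta>" using y0U unfolding U_def by simp
    have L: "Ln (of_real y0) = of_real (ln y0)" by (rule Ln_of_real[OF y0(1)])
    let ?z = "complex_of_real y0"
    have "(f has_field_derivative (- (Ln ?z + 1) * (?z ^ 3 - of_real \<eta>) - - ?z * Ln ?z * (3 * ?z\<^sup>2))
        / ((?z ^ 3 - of_real \<eta>) * (?z ^ 3 - of_real \<eta>))) (at ?z)"
      unfolding f_def
    proof (rule DERIV_divide)
      show "((\<lambda>z. - z * Ln z) has_field_derivative - (Ln ?z + 1)) (at ?z)"
        using y0 nonpos[of ?z] by (auto intro!: derivative_eq_intros)
      show "((\<lambda>z. z ^ 3 - of_real \<eta>) has_field_derivative 3 * ?z\<^sup>2) (at ?z)"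
        by (auto intro!: derivative_eq_intros)
    qed (use nz in simp)
    moreover have "- (Ln ?z + 1) * (?z ^ 3 - of_real \<eta>) - - ?z * Ln ?z * (3 * ?z\<^sup>2)
        = Ln ?z * (2 * ?z ^ 3 + of_real \<eta>) - (?z ^ 3 - of_real \<eta>)"
      by (simp add: algebra_simps power2_eq_square power3_eq_cube)
    ultimately have "(f has_field_derivative (Ln ?z * (2 * ?z ^ 3 + of_real \<eta>) - (?z ^ 3 - of_real \<eta>))
        / (?z ^ 3 - of_real \<eta>)\<^sup>2) (at ?z)"
      by (simp only: power2_eq_square)
    then have "deriv f (of_real y0) = of_real ((ln y0 * (2 * y0 ^ 3 + \<eta>) - (y0 ^ 3 - \<eta>)) / (y0 ^ 3 - \<eta>)\<^sup>2)"
      unfolding L by (simp add: DERIV_imp_deriv)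
    moreover have "ln y0 * (2 * y0 ^ 3 + \<eta>) < 0" using y0 \<eta> by (intro mult_neg_pos add_pos_pos) auto
    then have "(ln y0 * (2 * y0 ^ 3 + \<eta>) - (y0 ^ 3 - \<eta>)) / (y0 ^ 3 - \<eta>)\<^sup>2 \<noteq> 0" using y0 by auto
    ultimately show ?thesis by (simp only: of_real_eq_0_iff not_False_eq_True)
  qed
  then obtain \<rho> where \<rho>: "0 < \<rho>" "ball (of_real y0) \<rho> \<subseteq> U" "open (f ` ball (of_real y0) \<rho>)"
      "inj_on f (ball (of_real y0) \<rho>)"
    using has_complex_derivative_locally_invertible[OF f y0U U] by blast
  obtain g where g: "g holomorphic_on f ` ball (of_real y0) \<rho>" "\<And>z. z \<in> ball (of_real y0) \<rho> \<Longrightarrow> g (f z) = z"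
    using holomorphic_has_inverse[OF holomorphic_on_subset[OF f \<rho>(2)] open_ball \<rho>(4)] by metis
  let ?V = "f ` ball (complex_of_real y0) \<rho>"
  have fy0: "f (of_real y0) = (of_real c0)\<^sup>2" using f_real[OF y0(1)] kY[OF c0] unfolding y0_def by simp
  have "(of_real c0)\<^sup>2 \<in> ?V" unfolding fy0[symmetric] using \<rho> by (intro imageI) simp
  moreover have "open ((\<lambda>w. w\<^sup>2) -` ?V)" using \<rho>(3) by (intro open_vimage continuous_intros)
  ultimately obtain r1 where r1: "0 < r1" "ball (complex_of_real c0) r1 \<subseteq> (\<lambda>w. w\<^sup>2) -` ?V"
    by (metis open_contains_ball vimageI)
  have "\<forall>\<^sub>F y in nhds y0. \<eta> < y ^ 3"
    using y0 by (intro order_tendstoD(1)[of "\<lambda>y. y ^ 3" "y0 ^ 3"] tendsto_power filterlim_ident)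
  then obtain d0 where d0: "0 < d0" "\<And>y. \<bar>y - y0\<bar> < d0 \<Longrightarrow> \<eta> < y ^ 3"
    unfolding eventually_nhds_metric dist_real_def by blast
  define d where "d = min (min \<rho> d0) (min y0 (1 - y0)) / 2"
  have d: "0 < d" "d < \<rho>" "d < d0" "d < y0" "d < 1 - y0" using \<rho> d0 y0 unfolding d_def by auto
  have e1: "\<eta> < (y0 - d) ^ 3" using d0(2)[of "y0 - d"] d by simp
  have "k y0 < k (y0 - d)" unfolding k_def using d y0 e1 \<eta> by (intro saddle_antimono) auto
  moreover have "k (y0 + d) < k y0" unfolding k_def using d y0 \<eta> by (intro saddle_antimono) auto
  ultimately have k0: "k (y0 + d) < c0\<^sup>2" "c0\<^sup>2 < k (y0 - d)" using kY[OF c0] unfolding y0_def by auto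
  have "\<forall>\<^sub>F c in nhds c0. k (y0 + d) < c\<^sup>2 \<and> c\<^sup>2 < k (y0 - d)"
    using k0 by (intro eventually_conj order_tendstoD[of "\<lambda>c. c\<^sup>2" "c0\<^sup>2"] tendsto_power filterlim_ident)
  then obtain r2 where r2: "0 < r2" "\<And>c. \<bar>c - c0\<bar> < r2 \<Longrightarrow> k (y0 + d) < c\<^sup>2 \<and> c\<^sup>2 < k (y0 - d)"
    unfolding eventually_nhds_metric dist_real_def by blast
  \<comment> \<open>\<open>Y\<close> is only some choice of solutions, with no continuity assumed.
    Strict monotonicity of k traps \<open>Y c\<close> between y0 - d and y0 + d, inside the ball on
    which g inverts f.\<close>
  have near: "\<bar>Y c - y0\<bar> < \<rho>" if c: "0 < c" "\<bar>c - c0\<bar> < r2" for c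
  proof -
    note Yc = Y[OF c(1)]
    have "y0 - d < Y c"
    proof (rule ccontr)
      assume "\<not> y0 - d < Y c"
      then have "k (y0 - d) \<le> k (Y c)"
        using saddle_antimono[OF \<eta>, of "Y c" "y0 - d"] Yc d y0 unfolding k_def
        by (cases "Y c = y0 - d") auto
      then show False using r2(2)[OF c(2)] kY[OF c(1)] by simp
    qed
    moreover have "Y c < y0 + d"
    proof (rule ccontr)
      assume "\<not> Y c < y0 + d"
      moreover have "\<eta> < (y0 + d) ^ 3" using d0(2)[of "y0 + d"] d by simp
      ultimately have "k (Y c) \<le> k (y0 + d)"
        using saddle_antimono[OF \<eta>, of "y0 + d" "Y c"] Yc d y0 unfolding k_def
        by (cases "Y c = y0 + d") auto
      then show False using r2(2)[OF c(2)] kY[OF c(1)] by simp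
    qed
    ultimately show ?thesis using d by linarith
  qed
  define r where "r = min c0 (min r1 r2)"
  have r: "0 < r" "r \<le> c0" "r \<le> r1" "r \<le> r2" unfolding r_def using c0 r1 r2 by auto
  have ball: "w\<^sup>2 \<in> ?V" if "w \<in> ball (of_real c0) r" for w
  proof -
    have "w \<in> ball (of_real c0) r1" using that r by simp
    then show ?thesis using r1(2) by blast
  qed
  show thesis
  proof (rule that[of r "\<lambda>w. g (w\<^sup>2)"])
    show "(\<lambda>w. g (w\<^sup>2)) holomorphic_on ball (of_real c0) r"
    proof (rule holomorphic_on_compose_gen[OF _ g(1), unfolded comp_def])
      show "(\<lambda>w. w\<^sup>2) holomorphic_on ball (of_real c0) r" by (intro holomorphic_intros)
    qed (use ball in blast)
    show "0 < Re (g (w\<^sup>2))" if w: "w \<in> ball (of_real c0) r" for w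
    proof -
      obtain z where z: "z \<in> ball (of_real y0) \<rho>" "w\<^sup>2 = f z" using ball[OF w] by blast
      then show ?thesis using g(2) \<rho>(2) unfolding U_def by auto
    qed
    show "g ((of_real c)\<^sup>2) = of_real (Y c)" if "\<bar>c - c0\<bar> < r" for c
    proof -
      have c: "0 < c" "\<bar>c - c0\<bar> < r2" using that r by auto
      have "dist (complex_of_real y0) (of_real (Y c)) = \<bar>Y c - y0\<bar>"
        by (metis dist_commute dist_of_real dist_real_def)
      then have "of_real (Y c) \<in> ball (complex_of_real y0) \<rho>" using near[OF c] by simp
      from g(2)[OF this] show ?thesis using f_real[of "Y c"] kY[OF c(1)] Y[OF c(1)] by simp
    qed
  qed (use r in auto)
qed

theorem corollary1p4:
  fixes \<eta> :: real
  assumes "eta_star \<le> \<eta>" and "\<eta> < 1"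
  shows "(\<forall>c>0. \<bar>phi \<eta> c\<bar> \<noteq> \<infinity>)
       \<and> real_analytic_on (\<lambda>c. real_of_ereal (phi \<eta> c)) {0<..}
       \<and> (\<forall>c>0. (\<lambda>n. ereal (lower_tail_rate \<eta> c n)) \<longlonglongrightarrow> phi \<eta> c)"
proof -
  have \<eta>: "0 < \<eta>" using eta_star_pos assms(1) by (rule order_less_le_trans)
  have "\<forall>c. \<exists>y. 0 < c \<longrightarrow> 0 < y \<and> y < 1 \<and> \<eta> < y ^ 3 \<and> c\<^sup>2 * (y ^ 3 - \<eta>) = - y * ln y"
  proof
    fix c :: real
    show "\<exists>y. 0 < c \<longrightarrow> 0 < y \<and> y < 1 \<and> \<eta> < y ^ 3 \<and> c\<^sup>2 * (y ^ 3 - \<eta>) = - y * ln y"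
    proof (cases "0 < c")
      case True
      from saddle_exists[OF \<eta> assms(2) this] show ?thesis by blast
    qed simp
  qed
  from choice[OF this] obtain Y where Y: "\<And>c. 0 < c \<Longrightarrow>
      0 < Y c \<and> Y c < 1 \<and> \<eta> < Y c ^ 3 \<and> c\<^sup>2 * (Y c ^ 3 - \<eta>) = - Y c * ln (Y c)" by blast
  \<comment> \<open>The limit from \<open>lower_tail_rate_tendsto\<close>; at the saddle point - ln
    q equals 3 ln y - ln \<eta>.\<close>
  define R where "R c = c / 2 * (Y c - 1) - c / 3 * (Y c * ln (Y c)) + (3 * ln (Y c) - ln \<eta>) * (\<eta> * c ^ 3 / 6)" for c
  have rate: "lower_tail_rate \<eta> c \<longlonglongrightarrow> R c" if c: "0 < c" for c
  proof -
    note y = Y[OF c]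
    have "ln (Y c) = - (c\<^sup>2 * (Y c ^ 3 - \<eta>)) / Y c" using y by (simp add: field_simps)
    then have q: "tilt c (Y c) = \<eta> / Y c ^ 3"
      unfolding tilt_def using y c by (simp add: field_simps power2_eq_square power3_eq_cube)
    have "- ln (tilt c (Y c)) = 3 * ln (Y c) - ln \<eta>" unfolding q using y \<eta> by (simp add: ln_div ln_realpow)
    then show ?thesis
      using lower_tail_rate_tendsto[OF assms(1) c _ _ _ q] y unfolding R_def tilted_pressure_def by simp
  qed
  have ereal_rate: "(\<lambda>n. ereal (lower_tail_rate \<eta> c n)) \<longlonglongrightarrow> ereal (R c)" if "0 < c" for c
    using rate[OF that] by simp
  have phi: "phi \<eta> c = ereal (R c)" if "0 < c" for c
    unfolding phi_def by (rule lim_imp_Liminf[OF _ ereal_rate[OF that]]) simp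
  have "real_analytic_on (\<lambda>c. real_of_ereal (phi \<eta> c)) {0<..}"
  proof (rule real_analytic_on_Re_holomorphic)
    fix c0 :: real assume "c0 \<in> {0<..}"
    then have c0: "0 < c0" by simp
    obtain G r where r: "0 < r" "r \<le> c0" and G: "G holomorphic_on ball (complex_of_real c0) r"
      and Gpos: "\<And>w. w \<in> ball (complex_of_real c0) r \<Longrightarrow> 0 < Re (G w)"
      and GY: "\<And>c. \<bar>c - c0\<bar> < r \<Longrightarrow> G (complex_of_real c) = of_real (Y c)"
      by (rule saddle_holomorphic[OF \<eta> c0 Y]) (assumption | rule that)+
    \<comment> \<open>The complex version of \<open>R\<close>, with the holomorphic saddle point
      \<open>G\<close> in place of \<open>Y\<close>; positivity of Re (G w) keeps
      \<open>Ln (G w)\<close> off the branch cut.\<close>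
    define F where "F w = w / 2 * (G w - 1) - w / 3 * (G w * Ln (G w))
        + (3 * Ln (G w) - of_real (ln \<eta>)) * (of_real \<eta> * w ^ 3 / 6)" for w
    have "F holomorphic_on ball (of_real c0) r"
      unfolding F_def using Gpos
      by (intro holomorphic_intros G) (auto simp: complex_nonpos_Reals_iff not_le)
    moreover have "real_of_ereal (phi \<eta> (c0 + h)) = Re (F (of_real (c0 + h)))" if h: "\<bar>h\<bar> < r" for h
    proof -
      have c: "0 < c0 + h" using h r by linarith
      have "G (of_real (c0 + h)) = of_real (Y (c0 + h))" using GY[of "c0 + h"] h by simp
      moreover have "Ln (of_real (Y (c0 + h))) = of_real (ln (Y (c0 + h)))" using Y[OF c] by (intro Ln_of_real) auto
      ultimately have "F (of_real (c0 + h)) = of_real (R (c0 + h))"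
        unfolding F_def R_def by simp
      then show ?thesis unfolding phi[OF c] by simp
    qed
    ultimately show "\<exists>F r. 0 < r \<and> F holomorphic_on ball (complex_of_real c0) r \<and>
        (\<forall>h. \<bar>h\<bar> < r \<longrightarrow> real_of_ereal (phi \<eta> (c0 + h)) = Re (F (of_real (c0 + h))))"
      using r(1) by (intro exI[of _ F] exI[of _ r]) simp
  qed
  then show ?thesis using phi ereal_rate by simp
qed

end
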